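(* Let $a,b$ be integers such that $x^7+ax+b$ is irreducible over $\mathbb{Q}$, let $\theta$ be a root of this polynomial and $K=\mathbb{Q}(\theta)$. If both $a+4$ and $b$ are divisible by $32$, then $K$ is non-monogenic.
   Context: A number field $K$ of degree $n$ with ring of integers $\mathbb{O}_K$ is monogenic if there is $\alpha\in\mathbb{O}_K$ such that $\{1,\alpha,\dots,\alpha^{n-1}\}$ is a $\mathbb{Z}$-basis of $\mathbb{O}_K$ (i.e. $\mathbb{O}_K=\mathbb{Z}[\alpha]$); otherwise it is non-monogenic. *)

theory Defs
  imports "HOL-Computational_Algebra.Polynomial"
begin

text \<open>
  Number fields are represented as subfields of an ambient field of characteristic zero, given
  by a type of class \<open>field_char_0\<close>; such a type carries canonical scalar actions of the
  rationals and the integers, for which the library notions of dimension, span and independence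
  are used.
\<close>

global_interpretation rat_vs: vector_space "\<lambda>(q::rat) (x::'a::field_char_0). of_rat q * x"
  by unfold_locales (simp_all add: of_rat_add of_rat_mult algebra_simps)

global_interpretation int_mod: module "\<lambda>(k::int) (x::'a::field_char_0). of_int k * x"
  by unfold_locales (simp_all add: algebra_simps)

definition is_subfield :: "'a::field_char_0 set \<Rightarrow> bool" where
  "is_subfield K \<longleftrightarrow> 1 \<in> K \<and> (\<forall>x\<in>K. \<forall>y\<in>K. x - y \<in> K) \<and> (\<forall>x\<in>K. \<forall>y\<in>K. x * y \<in> K)
     \<and> (\<forall>x\<in>K. inverse x \<in> K)"

text \<open>The field \<open>\<rat>(\<theta>)\<close>: every subfield contains the rationals, as the characteristic is zero.\<close>

definition rat_adjoin :: "'a::field_char_0 \<Rightarrow> 'a set" where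
  "rat_adjoin \<theta> = \<Inter> {F. is_subfield F \<and> \<theta> \<in> F}"

definition field_degree :: "'a::field_char_0 set \<Rightarrow> nat" where
  "field_degree K = rat_vs.dim K"

definition ring_of_integers :: "'a::field_char_0 set \<Rightarrow> 'a set" where
  "ring_of_integers K = {x \<in> K. algebraic_int x}"

definition is_int_basis :: "'a::field_char_0 set \<Rightarrow> 'a set \<Rightarrow> bool" where
  "is_int_basis B M \<longleftrightarrow> int_mod.independent B \<and> int_mod.span B = M"

text \<open>
  To be used only for a number field \<open>K\<close>, that is, a subfield of finite dimension over the
  rationals: the library's dimension is \<open>0\<close> in the infinite-dimensional case.
\<close>

definition monogenic :: "'a::field_char_0 set \<Rightarrow> bool" where
  "monogenic K \<longleftrightarrow>
     (\<exists>\<alpha>\<in>ring_of_integers K. is_int_basis ((\<lambda>i. \<alpha> ^ i) ` {..<field_degree K}) (ring_of_integers K))"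

end

theory Submission
  imports Defs "Jordan_Normal_Form.Char_Poly" "HOL-Computational_Algebra.Field_as_Ring"
begin

text \<open>
  Over the 2-adic numbers the polynomial splits into a linear factor and two totally ramified cubic
  ones, so \<open>2\<close> has three prime divisors of residue degree one in \<open>K\<close>. A ring \<open>Z[\<alpha>]\<close> has at most two
  homomorphisms to the field \<open>F\<^sub>2\<close>, so it cannot be the ring of integers \<open>R\<close>.

  To see this without localising, put \<open>u = \<theta>\<^sup>3 / 2\<close> and \<open>w = (u\<^sup>2 - u) / 2\<close>. Both are integral, and
  they are idempotent modulo the radical \<open>J\<close> of \<open>2 R\<close>, with \<open>u w = w\<close> modulo \<open>J\<close>. The trace is
  even on \<open>J\<close>, since \<open>Tr (x\<^sup>2)\<close> and \<open>Tr x\<close> have the same parity; as \<open>Tr 1 = 7\<close>,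
  \<open>Tr u = 0\<close> and \<open>Tr w = - 3 a / 4\<close> is odd, the elements \<open>1\<close>, \<open>u\<close>, \<open>w\<close> are independent modulo \<open>J\<close>.
  It follows that \<open>1\<close>, \<open>u\<close>, \<open>w\<close>, \<open>\<theta>\<close>, \<open>\<theta> w\<close>, \<open>\<theta>\<^sup>2\<close>, \<open>\<theta>\<^sup>2 w\<close> are independent modulo \<open>2 R\<close>, hence span
  \<open>R / 2 R\<close>, and so every element of \<open>R\<close> is idempotent modulo \<open>J\<close>. If \<open>R = Z[\<alpha>]\<close>, then
  \<open>1\<close> and \<open>\<alpha>\<close> span \<open>R / J\<close> over \<open>F\<^sub>2\<close>, which contradicts the independence of \<open>1\<close>, \<open>u\<close>, \<open>w\<close>.
\<close>

section \<open>Sums and products of algebraic integers\<close>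

text \<open>Multiplication by \<open>x\<close> acts on the generators \<open>V\<close> through an
  integer matrix. The vector of generators is an eigenvector for \<open>x\<close>, nonzero because
  of \<open>v\<close>, so \<open>x\<close> is a root of the monic integral characteristic
  polynomial.\<close>

lemma algebraic_int_if_span_stable:
  fixes x :: "'a::field_char_0"
  assumes V: "finite V" "v \<in> V" "v \<noteq> 0"
    and stable: "\<And>y. y \<in> V \<Longrightarrow> x * y \<in> int_mod.span V"
  shows "algebraic_int x"
proof -
  obtain f where f: "bij_betw f {0..<card V} V"
    using ex_bij_betw_nat_finite[OF V(1)] by blast
  define n where "n = card V"
  have "\<exists>c. x * y = (\<Sum>z\<in>V. of_int (c z) * z)" if "y \<in> V" for y
    using stable[OF that] unfolding int_mod.span_finite[OF V(1)] by blast
  then obtain c :: "'a \<Rightarrow> 'a \<Rightarrow> int"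
    where c: "\<And>y. y \<in> V \<Longrightarrow> x * y = (\<Sum>z\<in>V. of_int (c y z) * z)"
    by metis
  define M where "M = mat n n (\<lambda>(i, j). c (f i) (f j))"
  let ?M = "map_mat of_int M :: 'a mat"
  have M: "M \<in> carrier_mat n n" and M': "?M \<in> carrier_mat n n" by (auto simp: M_def)
  define e where "e = vec n f"
  have fV: "f i \<in> V" if "i < n" for i
    using that f unfolding bij_betw_def n_def by auto
  have "?M *\<^sub>v e = x \<cdot>\<^sub>v e"
  proof (rule eq_vecI)
    fix i assume "i < dim_vec (x \<cdot>\<^sub>v e)"
    hence i: "i < n" by (simp add: e_def)
    have "(?M *\<^sub>v e) $ i = (\<Sum>j\<in>{0..<n}. of_int (c (f i) (f j)) * f j)"
      using i by (auto simp: M_def e_def scalar_prod_def intro!: sum.cong)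
    also have "\<dots> = (\<Sum>z\<in>V. of_int (c (f i) z) * z)"
      using sum.reindex_bij_betw[OF f, of "\<lambda>z. of_int (c (f i) z) * z"] by (simp add: n_def)
    also have "\<dots> = x * f i" using c[OF fV[OF i]] by simp
    finally show "(?M *\<^sub>v e) $ i = (x \<cdot>\<^sub>v e) $ i" using i by (simp add: e_def)
  qed (auto simp: M_def e_def)
  moreover have "e \<noteq> 0\<^sub>v n"
  proof -
    obtain i where "i < n" "f i = v"
      using V(2) f unfolding bij_betw_def n_def by (metis atLeastLessThan_iff imageE)
    thus ?thesis using V(3) by (metis e_def index_vec index_zero_vec(1))
  qed
  ultimately have "eigenvector ?M e x"
    using M' by (auto simp: eigenvector_def e_def)
  hence "eigenvalue ?M x" by (auto simp: eigenvalue_def)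
  hence "poly (char_poly ?M) x = 0"
    using eigenvalue_root_char_poly[OF M'] by simp
  moreover have "char_poly ?M = map_poly of_int (char_poly M)"
    by (rule of_int_hom.char_poly_hom[OF M])
  moreover have "lead_coeff (char_poly M) = 1"
    using degree_monic_char_poly[OF M] by simp
  ultimately show ?thesis
    unfolding algebraic_int_altdef_ipoly by auto
qed

lemma int_span_mult:
  fixes x :: "'a::field_char_0"
  assumes "\<And>y. y \<in> V \<Longrightarrow> x * y \<in> int_mod.span V" "z \<in> int_mod.span V"
  shows "x * z \<in> int_mod.span V"
  using assms(2)
proof (induction rule: int_mod.span_induct_alt)
  case base
  show ?case by (simp add: int_mod.span_zero)
next
  case (step k y z)
  have "x * (of_int k * y + z) = of_int k * (x * y) + x * z" by (simp add: algebra_simps)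
  thus ?case using step assms(1) by (simp add: int_mod.span_add int_mod.span_scale)
qed

lemma algebraic_int_span_powers:
  fixes x :: "'a::field_char_0"
  assumes "algebraic_int x"
  obtains n where "x ^ n \<in> int_mod.span ((\<lambda>i. x ^ i) ` {..<n})" "n > 0"
proof -
  obtain p where p: "poly (map_poly of_int p) x = 0" "lead_coeff p = (1::int)"
    using assms unfolding algebraic_int_altdef_ipoly by blast
  define n where "n = degree p"
  have "n > 0"
    using p by (cases "degree p") (auto simp: n_def elim!: degree_eq_zeroE)
  have "0 = (\<Sum>i\<le>n. of_int (coeff p i) * x ^ i)"
    using p(1) by (simp add: poly_altdef degree_map_poly coeff_map_poly n_def)
  also have "\<dots> = (\<Sum>i<n. of_int (coeff p i) * x ^ i) + x ^ n"
    using p(2) by (simp add: lessThan_Suc_atMost[symmetric] n_def)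
  finally have "x ^ n = - (\<Sum>i<n. of_int (coeff p i) * x ^ i)"
    by (simp add: eq_neg_iff_add_eq_0 add.commute)
  also have "\<dots> \<in> int_mod.span ((\<lambda>i. x ^ i) ` {..<n})"
    by (intro int_mod.span_neg int_mod.span_sum int_mod.span_scale int_mod.span_base) auto
  finally show ?thesis using that \<open>n > 0\<close> by blast
qed

text \<open>The products \<open>x ^ i * y ^ j\<close> with bounded exponents serve as
  \<open>V\<close>. The element \<open>1\<close> is the nonzero generator that the eigenvector
  argument asks for.\<close>

lemma algebraic_int_common_span:
  fixes x y :: "'a::field_char_0"
  assumes "algebraic_int x" "algebraic_int y"
  obtains V where "finite V" "1 \<in> V"
    "\<And>v. v \<in> V \<Longrightarrow> x * v \<in> int_mod.span V" "\<And>v. v \<in> V \<Longrightarrow> y * v \<in> int_mod.span V"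
proof -
  \<comment> \<open>Multiplying by \<open>x\<close> raises the exponent by one. Only the top
    exponent leaves the range, and there \<open>m\<close> rewrites \<open>x ^ m\<close> in lower
    powers.\<close>
  have key: "x * (x ^ i * z) \<in> int_mod.span (\<Union>i<m. (\<lambda>z. x ^ i * z) ` W)"
    if m: "x ^ m \<in> int_mod.span ((\<lambda>i. x ^ i) ` {..<m})" and "i < m" "z \<in> W"
    for x z :: 'a and W m i
  proof (cases "Suc i = m")
    case False
    have "x * (x ^ i * z) = x ^ Suc i * z" by simp
    thus ?thesis using that False
      by (intro int_mod.span_base UN_I[of "Suc i"]) auto
  next
    case True
    have "t * z \<in> int_mod.span (\<Union>i<m. (\<lambda>z. x ^ i * z) ` W)"
      if "t \<in> int_mod.span ((\<lambda>i. x ^ i) ` {..<m})" for t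
      using that
    proof (induction rule: int_mod.span_induct_alt)
      case (step k r s)
      have "(of_int k * r + s) * z = of_int k * (r * z) + s * z" by (simp add: algebra_simps)
      moreover have "r * z \<in> int_mod.span (\<Union>i<m. (\<lambda>z. x ^ i * z) ` W)"
        using step(1) \<open>z \<in> W\<close> by (intro int_mod.span_base) auto
      ultimately show ?case using step.IH by (simp only: int_mod.span_add int_mod.span_scale)
    qed (simp add: int_mod.span_zero)
    from this[OF m] show ?thesis using True by (auto simp: mult_ac)
  qed
  obtain m where m: "x ^ m \<in> int_mod.span ((\<lambda>i. x ^ i) ` {..<m})" "m > 0"
    using algebraic_int_span_powers[OF assms(1)] .
  obtain n where n: "y ^ n \<in> int_mod.span ((\<lambda>i. y ^ i) ` {..<n})" "n > 0"
    using algebraic_int_span_powers[OF assms(2)] .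
  define V where "V = (\<Union>i<m. (\<lambda>z. x ^ i * z) ` (\<lambda>j. y ^ j) ` {..<n})"
  \<comment> \<open>The same products grouped by powers of \<open>y\<close>, so that
    \<open>key\<close> applies to \<open>y\<close> as well.\<close>
  have V': "V = (\<Union>j<n. (\<lambda>z. y ^ j * z) ` (\<lambda>i. x ^ i) ` {..<m})"
    unfolding V_def by (force simp: mult.commute)
  show ?thesis
  proof
    show "finite V" by (auto simp: V_def)
    show "1 \<in> V" using m(2) n(2) unfolding V_def
      by (auto simp: image_iff intro!: bexI[of _ 0])
    show "x * v \<in> int_mod.span V" if "v \<in> V" for v
    proof -
      obtain i z where iz: "v = x ^ i * z" "i < m" "z \<in> (\<lambda>j. y ^ j) ` {..<n}"
        using \<open>v \<in> V\<close> unfolding V_def by blast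
      show ?thesis unfolding iz(1) V_def by (rule key[OF m(1) iz(2,3)])
    qed
    show "y * v \<in> int_mod.span V" if "v \<in> V" for v
    proof -
      obtain j z where jz: "v = y ^ j * z" "j < n" "z \<in> (\<lambda>i. x ^ i) ` {..<m}"
        using \<open>v \<in> V\<close> unfolding V' by blast
      show ?thesis unfolding jz(1) V' by (rule key[OF n(1) jz(2,3)])
    qed
  qed
qed

lemma algebraic_int_add_mult:
  fixes x y :: "'a::field_char_0"
  assumes "algebraic_int x" "algebraic_int y"
  shows algebraic_int_add: "algebraic_int (x + y)"
    and algebraic_int_mult: "algebraic_int (x * y)"
proof -
  obtain V where V: "finite V" "1 \<in> V"
    "\<And>v. v \<in> V \<Longrightarrow> x * v \<in> int_mod.span V" "\<And>v. v \<in> V \<Longrightarrow> y * v \<in> int_mod.span V"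
    using algebraic_int_common_span[OF assms] by blast
  show "algebraic_int (x + y)"
    by (rule algebraic_int_if_span_stable[OF V(1,2)])
       (auto simp: ring_distribs intro!: int_mod.span_add V(3,4))
  show "algebraic_int (x * y)"
    by (rule algebraic_int_if_span_stable[OF V(1,2)])
       (simp_all add: mult.assoc int_span_mult[of V x] V(3,4) del: int_mod.span_base)
qed

section \<open>The trace with respect to a basis\<close>

text \<open>The trace comes in two versions. The rational one is independent of the basis and can be
  computed in the powers of \<open>\<theta>\<close>; the integral one, for a basis of the ring of
  integers, gives parities a meaning.\<close>

definition rat_trace :: "'a::field_char_0 set \<Rightarrow> 'a \<Rightarrow> rat" where
  "rat_trace B y = (\<Sum>b\<in>B. rat_vs.representation B (y * b) b)"

definition int_trace :: "'a::field_char_0 set \<Rightarrow> 'a \<Rightarrow> int" where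
  "int_trace B y = (\<Sum>b\<in>B. int_mod.representation B (y * b) b)"

text \<open>This is \<open>Tr (P Q) = Tr (Q P)\<close>: expanding \<open>y * b\<close> in
  \<open>C\<close> and \<open>c\<close> in \<open>B\<close> turns both traces into the same double
  sum.\<close>

lemma rat_trace_basis_independent:
  fixes B C :: "'a::field_char_0 set"
  assumes B: "finite B" "rat_vs.independent B" and C: "finite C" "rat_vs.independent C"
    and span: "rat_vs.span B = rat_vs.span C"
    and y: "\<And>b. b \<in> rat_vs.span B \<Longrightarrow> y * b \<in> rat_vs.span B"
  shows "rat_trace B y = rat_trace C y"
proof -
  let ?rB = "rat_vs.representation B" and ?rC = "rat_vs.representation C"
  have BC: "b \<in> rat_vs.span B" if "b \<in> B \<or> b \<in> C" for b
    using that rat_vs.span_base span by blast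
  have rB: "?rB (\<Sum>c\<in>S. of_rat (q c) * x c) b = (\<Sum>c\<in>S. q c * ?rB (x c) b)"
    if "\<And>c. c \<in> S \<Longrightarrow> x c \<in> rat_vs.span B" for S :: "'a set" and q x b
  proof -
    have "?rB (\<Sum>c\<in>S. of_rat (q c) * x c) = (\<lambda>b. \<Sum>c\<in>S. ?rB (of_rat (q c) * x c) b)"
      by (rule rat_vs.representation_sum[OF B(2)]) (auto intro: rat_vs.span_scale that)
    thus ?thesis using that by (simp add: rat_vs.representation_scale[OF B(2)])
  qed
  have rC: "?rC (\<Sum>c\<in>S. of_rat (q c) * x c) b = (\<Sum>c\<in>S. q c * ?rC (x c) b)"
    if "\<And>c. c \<in> S \<Longrightarrow> x c \<in> rat_vs.span B" for S :: "'a set" and q x b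
  proof -
    have "?rC (\<Sum>c\<in>S. of_rat (q c) * x c) = (\<lambda>b. \<Sum>c\<in>S. ?rC (of_rat (q c) * x c) b)"
      by (rule rat_vs.representation_sum[OF C(2)]) (use that span in \<open>auto intro: rat_vs.span_scale\<close>)
    thus ?thesis using that span by (simp add: rat_vs.representation_scale[OF C(2)])
  qed
  have expC: "x = (\<Sum>c\<in>C. of_rat (?rC x c) * c)" if "x \<in> rat_vs.span B" for x
    using rat_vs.sum_representation_eq[OF C(2) that[unfolded span] C(1) subset_refl] by simp
  have expB: "x = (\<Sum>b\<in>B. of_rat (?rB x b) * b)" if "x \<in> rat_vs.span B" for x
    using rat_vs.sum_representation_eq[OF B(2) that B(1) subset_refl] by simp
  have "rat_trace B y = (\<Sum>b\<in>B. \<Sum>c\<in>C. ?rC (y * b) c * ?rB c b)"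
    unfolding rat_trace_def
  proof (rule sum.cong)
    fix b assume "b \<in> B"
    have "y * b \<in> rat_vs.span B" using y BC \<open>b \<in> B\<close> by blast
    from expC[OF this] have "?rB (y * b) b = ?rB (\<Sum>c\<in>C. of_rat (?rC (y * b) c) * c) b"
      by (rule arg_cong)
    also have "\<dots> = (\<Sum>c\<in>C. ?rC (y * b) c * ?rB c b)"
      by (rule rB) (use BC in auto)
    finally show "?rB (y * b) b = (\<Sum>c\<in>C. ?rC (y * b) c * ?rB c b)" .
  qed simp
  also have "\<dots> = (\<Sum>c\<in>C. \<Sum>b\<in>B. ?rB c b * ?rC (y * b) c)"
    by (subst sum.swap) (simp add: mult.commute)
  also have "\<dots> = rat_trace C y"
    unfolding rat_trace_def
  proof (rule sum.cong)
    fix c assume "c \<in> C"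
    have "c \<in> rat_vs.span B" using BC \<open>c \<in> C\<close> by blast
    from expB[OF this] have "y * c = y * (\<Sum>b\<in>B. of_rat (?rB c b) * b)" by (rule arg_cong)
    also have "\<dots> = (\<Sum>b\<in>B. of_rat (?rB c b) * (y * b))"
      by (simp add: sum_distrib_left mult_ac)
    finally have "?rC (y * c) c = ?rC (\<Sum>b\<in>B. of_rat (?rB c b) * (y * b)) c" by (rule arg_cong)
    also have "\<dots> = (\<Sum>b\<in>B. ?rB c b * ?rC (y * b) c)"
      by (rule rC) (use BC y in auto)
    finally show "(\<Sum>b\<in>B. ?rB c b * ?rC (y * b) c) = ?rC (y * c) c" by (rule sym)
  qed simp
  finally show ?thesis .
qed

text \<open>An expansion with integer coefficients is also one with rational coefficients, and the
  latter is unique. This links the two versions of the trace.\<close>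

lemma of_int_int_representation:
  fixes B :: "'a::field_char_0 set"
  assumes "int_mod.independent B" "rat_vs.independent B" "x \<in> int_mod.span B"
  shows "rat_vs.representation B x b = of_int (int_mod.representation B x b)"
proof -
  let ?r = "int_mod.representation B x"
  have "rat_vs.representation B x = (\<lambda>b. of_int (?r b))"
  proof (rule rat_vs.representation_eqI[OF assms(2)])
    show "x \<in> rat_vs.span B"
      using assms(3)
    proof (induction rule: int_mod.span_induct_alt)
      case (step k y z)
      show ?case
        using rat_vs.span_add[OF rat_vs.span_scale[OF rat_vs.span_base[OF step(1)], of "of_int k"] step(2)]
        by simp
    qed (simp add: rat_vs.span_zero)
    show "b \<in> B" if "rat_of_int (?r b) \<noteq> 0" for b
      using that int_mod.representation_ne_zero[of B x b] by simp
    show "finite {b. rat_of_int (?r b) \<noteq> 0}"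
      using int_mod.finite_representation[of B x] by simp
    show "(\<Sum>b | rat_of_int (?r b) \<noteq> 0. of_rat (of_int (?r b)) * b) = x"
      using int_mod.sum_nonzero_representation_eq[OF assms(1,3)] by simp
  qed
  thus ?thesis by simp
qed

lemma of_int_int_trace:
  assumes "int_mod.independent B" "rat_vs.independent B"
    and "\<And>b. b \<in> B \<Longrightarrow> y * b \<in> int_mod.span B"
  shows "of_int (int_trace B y) = rat_trace B y"
  unfolding int_trace_def rat_trace_def
  using assms by (simp add: of_int_int_representation)

lemma int_trace_add:
  assumes "int_mod.independent B"
    and "\<And>b. b \<in> B \<Longrightarrow> x * b \<in> int_mod.span B" "\<And>b. b \<in> B \<Longrightarrow> y * b \<in> int_mod.span B"
  shows "int_trace B (x + y) = int_trace B x + int_trace B y"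
  unfolding int_trace_def sum.distrib[symmetric]
  using assms by (intro sum.cong) (auto simp: distrib_right int_mod.representation_add)

lemma int_trace_of_int_mult:
  assumes "int_mod.independent B" and "\<And>b. b \<in> B \<Longrightarrow> x * b \<in> int_mod.span B"
  shows "int_trace B (of_int k * x) = k * int_trace B x"
  unfolding int_trace_def sum_distrib_left
  using assms by (intro sum.cong) (auto simp: mult.assoc int_mod.representation_scale)

text \<open>Off-diagonal terms come in equal pairs.\<close>

lemma even_sum_symmetric_minus_diagonal:
  fixes f :: "'b \<Rightarrow> 'b \<Rightarrow> int"
  assumes "finite A" "\<And>x y. f x y = f y x"
  shows "even ((\<Sum>x\<in>A. \<Sum>y\<in>A. f x y) - (\<Sum>x\<in>A. f x x))"
  using assms(1)
proof (induction rule: finite_induct)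
  case (insert a A)
  have "(\<Sum>x\<in>insert a A. \<Sum>y\<in>insert a A. f x y) - (\<Sum>x\<in>insert a A. f x x)
      = ((\<Sum>x\<in>A. \<Sum>y\<in>A. f x y) - (\<Sum>x\<in>A. f x x)) + 2 * (\<Sum>x\<in>A. f a x)"
  proof -
    have "(\<Sum>x\<in>A. f x a) = (\<Sum>x\<in>A. f a x)" by (intro sum.cong assms(2) refl)
    thus ?thesis using insert(1,2) by (simp add: sum.distrib)
  qed
  thus ?case using insert.IH by simp
qed simp

text \<open>With \<open>m\<close> the matrix of multiplication by \<open>x\<close>, the trace of its
  square is a sum of symmetric terms \<open>m b c * m c b\<close>. Modulo 2 only the squares of the
  diagonal entries remain, and these have the parity of the entries themselves.\<close>

lemma int_trace_square_parity:
  assumes B: "finite B" "int_mod.independent B"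
    and x: "\<And>b. b \<in> B \<Longrightarrow> x * b \<in> int_mod.span B"
  shows "even (int_trace B (x ^ 2) - int_trace B x)"
proof -
  define m where "m b c = int_mod.representation B (x * b) c" for b c
  have "int_mod.representation B (x ^ 2 * b) b = (\<Sum>c\<in>B. m b c * m c b)" if "b \<in> B" for b
  proof -
    have "x * b = (\<Sum>c\<in>B. of_int (m b c) * c)"
      using int_mod.sum_representation_eq[OF B(2) x[OF that] B(1) subset_refl] by (simp add: m_def)
    hence "x * (x * b) = x * (\<Sum>c\<in>B. of_int (m b c) * c)" by (rule arg_cong)
    hence "x ^ 2 * b = (\<Sum>c\<in>B. of_int (m b c) * (x * c))"
      by (simp add: power2_eq_square sum_distrib_left mult_ac)
    also have "int_mod.representation B \<dots> b
        = (\<Sum>c\<in>B. int_mod.representation B (of_int (m b c) * (x * c)) b)"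
      by (subst int_mod.representation_sum[OF B(2)]) (auto intro: int_mod.span_scale x)
    also have "\<dots> = (\<Sum>c\<in>B. m b c * m c b)"
      by (intro sum.cong) (auto simp: int_mod.representation_scale[OF B(2)] x m_def)
    finally show ?thesis .
  qed
  hence "int_trace B (x ^ 2) = (\<Sum>b\<in>B. \<Sum>c\<in>B. m b c * m c b)"
    by (simp add: int_trace_def)
  moreover have "even ((\<Sum>b\<in>B. \<Sum>c\<in>B. m b c * m c b) - (\<Sum>b\<in>B. m b b * m b b))"
    by (rule even_sum_symmetric_minus_diagonal[OF B(1)]) (simp add: mult.commute)
  moreover have "even ((\<Sum>b\<in>B. m b b * m b b) - int_trace B x)"
    unfolding int_trace_def m_def[symmetric] sum_subtractf[symmetric]
    by (rule dvd_sum) auto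
  ultimately show ?thesis by presburger
qed

section \<open>The radical of \<open>2 R\<close>\<close>

locale subring_of_field =
  fixes R :: "'a::field_char_0 set"
  assumes one_closed: "1 \<in> R"
    and diff_closed: "x \<in> R \<Longrightarrow> y \<in> R \<Longrightarrow> x - y \<in> R"
    and mult_closed: "x \<in> R \<Longrightarrow> y \<in> R \<Longrightarrow> x * y \<in> R"
begin

lemma zero_closed: "0 \<in> R"
  using diff_closed[OF one_closed one_closed] by simp

lemma uminus_closed: "x \<in> R \<Longrightarrow> - x \<in> R"
  using diff_closed[OF zero_closed] by simp

lemma add_closed: "x \<in> R \<Longrightarrow> y \<in> R \<Longrightarrow> x + y \<in> R"
  using diff_closed[OF _ uminus_closed] by simp

lemma power_closed: "x \<in> R \<Longrightarrow> x ^ n \<in> R"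
  by (induction n) (auto intro: one_closed mult_closed)

lemma of_nat_closed: "of_nat n \<in> R"
  by (induction n) (auto intro: zero_closed one_closed add_closed)

lemma of_int_closed: "of_int k \<in> R"
  by (cases k) (auto intro: of_nat_closed uminus_closed diff_closed one_closed)

lemma numeral_closed: "numeral k \<in> R"
  using of_nat_closed[of "numeral k"] by simp

lemma sum_closed: "(\<And>i. i \<in> A \<Longrightarrow> f i \<in> R) \<Longrightarrow> sum f A \<in> R"
  by (induction A rule: infinite_finite_induct) (auto intro: zero_closed add_closed)

lemmas closed = zero_closed one_closed diff_closed uminus_closed add_closed mult_closed
  power_closed of_nat_closed of_int_closed numeral_closed

definition doubles :: "'a set" where
  "doubles = (\<lambda>x. 2 * x) ` R"

text \<open>Exponents that are powers of two suit the Frobenius map; by \<open>radicalI\<close> any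
  power lying in \<open>doubles\<close> is enough for membership.\<close>

definition radical :: "'a set" where
  "radical = {x \<in> R. \<exists>k. x ^ 2 ^ k \<in> doubles}"

lemma doublesI: "x \<in> R \<Longrightarrow> y = 2 * x \<Longrightarrow> y \<in> doubles"
  by (auto simp: doubles_def)

lemma doubles_subset: "x \<in> doubles \<Longrightarrow> x \<in> R"
  by (auto simp: doubles_def intro: closed)

lemma doubles_zero: "0 \<in> doubles"
  by (rule doublesI[OF zero_closed]) simp

lemma doubles_add:
  assumes "x \<in> doubles" "y \<in> doubles"
  shows "x + y \<in> doubles"
proof -
  from assms obtain r s where "r \<in> R" "s \<in> R" "x = 2 * r" "y = 2 * s"
    by (auto simp: doubles_def)
  thus ?thesis by (intro doublesI[of "r + s"] add_closed) (simp_all add: distrib_left)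
qed

lemma doubles_mult:
  assumes "r \<in> R" "x \<in> doubles"
  shows "r * x \<in> doubles"
proof -
  from assms obtain s where "s \<in> R" "x = 2 * s" by (auto simp: doubles_def)
  thus ?thesis using assms by (intro doublesI[of "r * s"] mult_closed) simp_all
qed

lemma doubles_uminus: "x \<in> doubles \<Longrightarrow> - x \<in> doubles"
  using doubles_mult[OF uminus_closed[OF one_closed]] by simp

lemma doubles_diff: "x \<in> doubles \<Longrightarrow> y \<in> doubles \<Longrightarrow> x - y \<in> doubles"
  using doubles_add[OF _ doubles_uminus] by simp

lemma doubles_power_mono:
  assumes "x \<in> R" "x ^ m \<in> doubles" "m \<le> n"
  shows "x ^ n \<in> doubles"
  using doubles_mult[OF power_closed[OF assms(1), of "n - m"] assms(2)] assms(3)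
  by (simp flip: power_add)

text \<open>Squaring is additive modulo \<open>2 R\<close>. Its iterates make the radical closed
  under addition, once a common exponent is chosen.\<close>

lemma frobenius_mod_doubles:
  assumes "x \<in> R" "y \<in> R"
  shows "(x + y) ^ 2 ^ k - (x ^ 2 ^ k + y ^ 2 ^ k) \<in> doubles"
proof (induction k)
  case (Suc k)
  then obtain r where r: "r \<in> R" "(x + y) ^ 2 ^ k - (x ^ 2 ^ k + y ^ 2 ^ k) = 2 * r"
    by (auto simp: doubles_def)
  define X Y where "X = x ^ 2 ^ k" and "Y = y ^ 2 ^ k"
  have [simp]: "X \<in> R" "Y \<in> R" using assms by (auto simp: X_def Y_def closed)
  have eq: "(x + y) ^ 2 ^ k = X + Y + 2 * r"
    using r(2) by (simp add: X_def Y_def algebra_simps)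
  have "(x + y) ^ 2 ^ Suc k - (x ^ 2 ^ Suc k + y ^ 2 ^ Suc k)
      = ((x + y) ^ 2 ^ k)\<^sup>2 - (X\<^sup>2 + Y\<^sup>2)"
    by (simp add: X_def Y_def power_mult[symmetric] mult.commute)
  also have "\<dots> = 2 * (X * Y + 2 * r * (X + Y) + 2 * r\<^sup>2)"
    unfolding eq by (simp add: power2_eq_square algebra_simps)
  finally show ?case by (rule doublesI[rotated]) (simp add: closed r(1))
qed (simp add: doubles_zero)

lemma doubles_subset_radical: "x \<in> doubles \<Longrightarrow> x \<in> radical"
  unfolding radical_def by (auto intro: doubles_subset exI[of _ 0])

lemma radical_subset: "x \<in> radical \<Longrightarrow> x \<in> R"
  by (simp add: radical_def)

lemma radical_zero: "0 \<in> radical"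
  by (intro doubles_subset_radical doubles_zero)

lemma radicalI:
  assumes "x \<in> R" "x ^ n \<in> doubles"
  shows "x \<in> radical"
  using doubles_power_mono[OF assms, of "2 ^ n"] assms(1)
  by (auto simp: radical_def)

lemma radical_mult:
  assumes "r \<in> R" "x \<in> radical"
  shows "r * x \<in> radical"
  using assms
  by (auto simp: radical_def power_mult_distrib intro!: closed doubles_mult exI)

lemma radical_add:
  assumes "x \<in> radical" "y \<in> radical"
  shows "x + y \<in> radical"
proof -
  from assms obtain k l where kl: "x \<in> R" "y \<in> R" "x ^ 2 ^ k \<in> doubles" "y ^ 2 ^ l \<in> doubles"
    by (auto simp: radical_def)
  define n where "n = max k l"
  have "x ^ 2 ^ n \<in> doubles" "y ^ 2 ^ n \<in> doubles"
    using doubles_power_mono[OF kl(1,3), of "2 ^ n"] doubles_power_mono[OF kl(2,4), of "2 ^ n"]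
    by (auto simp: n_def)
  hence "(x + y) ^ 2 ^ n \<in> doubles"
    using doubles_add[OF frobenius_mod_doubles[OF kl(1,2), of n] doubles_add] by fastforce
  thus ?thesis using kl by (auto simp: radical_def intro: closed)
qed

lemma radical_uminus: "x \<in> radical \<Longrightarrow> - x \<in> radical"
  using radical_mult[OF uminus_closed[OF one_closed]] by simp

lemma radical_diff: "x \<in> radical \<Longrightarrow> y \<in> radical \<Longrightarrow> x - y \<in> radical"
  using radical_add[OF _ radical_uminus] by simp

lemma idempotent_power:
  assumes "x \<in> R" "x\<^sup>2 - x \<in> radical" "n > 0"
  shows "x ^ n - x \<in> radical"
  using assms(3)
proof (induction n rule: nat_induct_non_zero)
  case (Suc n)
  have "x ^ Suc n - x = x * (x ^ n - x) + (x\<^sup>2 - x)"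
    by (simp add: algebra_simps power2_eq_square)
  thus ?case using Suc assms by (simp only: radical_add radical_mult)
qed (simp add: radical_zero)

lemma idempotent_add:
  assumes "x \<in> R" "x\<^sup>2 - x \<in> radical" "y \<in> R" "y\<^sup>2 - y \<in> radical"
  shows "(x + y)\<^sup>2 - (x + y) \<in> radical"
proof -
  have "(x + y)\<^sup>2 - (x + y) = ((x\<^sup>2 - x) + (y\<^sup>2 - y)) + 2 * (x * y)"
    by (simp add: power2_eq_square algebra_simps)
  moreover have "2 * (x * y) \<in> radical"
    using assms by (intro doubles_subset_radical doublesI[OF mult_closed]) auto
  ultimately show ?thesis using assms by (simp only: radical_add)
qed

lemma idempotent_of_int_mult:
  assumes "x \<in> R" "x\<^sup>2 - x \<in> radical"
  shows "(of_int k * x)\<^sup>2 - of_int k * x \<in> radical"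
proof -
  have "even (k ^ 2 - k)" by simp
  then obtain j where j: "k ^ 2 - k = 2 * j" by (elim evenE)
  have "(of_int k * x)\<^sup>2 - of_int k * x = of_int (k ^ 2) * (x\<^sup>2 - x) + of_int (k ^ 2 - k) * x"
    by (simp add: power2_eq_square algebra_simps)
  also have "\<dots> = of_int (k ^ 2) * (x\<^sup>2 - x) + 2 * (of_int j * x)"
    by (simp only: j) simp
  also have "\<dots> \<in> radical"
    using assms
    by (intro radical_add radical_mult doubles_subset_radical[OF doublesI[OF _ refl]] closed)
  finally show ?thesis .
qed

text \<open>The classes of \<open>R\<close> modulo \<open>2R\<close> correspond to the subsets of a basis, so linear
  independence modulo \<open>2R\<close> forces spanning by counting.\<close>

lemma spans_mod_two:
  assumes B: "finite B" "int_mod.independent B" "R = int_mod.span B"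
    and I: "finite I" "card I = card B" and v: "\<And>i. i \<in> I \<Longrightarrow> v i \<in> R"
    and indep: "\<And>m i. (\<Sum>i\<in>I. of_int (m i) * v i) \<in> doubles \<Longrightarrow> i \<in> I \<Longrightarrow> even (m i)"
    and x: "x \<in> R"
  obtains m :: "'i \<Rightarrow> int" where "x - (\<Sum>i\<in>I. of_int (m i) * v i) \<in> doubles"
proof -
  let ?r = "int_mod.representation B"
  \<comment> \<open>A class modulo \<open>doubles\<close> is recorded by the set of basis elements
    with odd coordinate; \<open>s\<close> lists the combinations of the \<open>v i\<close> with
    coefficients 0 and 1.\<close>
  define \<phi> where "\<phi> y = {b\<in>B. odd (?r y b)}" for y
  define s where "s S = (\<Sum>i\<in>I. of_int (of_bool (i \<in> S)) * v i)" for S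
  have sR: "s S \<in> R" for S
    unfolding s_def by (intro sum_closed closed v)
  have \<phi>: "y - z \<in> doubles" if "y \<in> R" "z \<in> R" "\<phi> y = \<phi> z" for y z
  proof -
    have yz: "y \<in> int_mod.span B" "z \<in> int_mod.span B" using that B by auto
    define c where "c b = ?r (y - z) b div 2" for b
    have c: "?r (y - z) b = 2 * c b" if "b \<in> B" for b
    proof -
      have "b \<in> \<phi> y \<longleftrightarrow> b \<in> \<phi> z" using \<open>\<phi> y = \<phi> z\<close> by simp
      hence "even (?r (y - z) b)"
        using that by (simp add: \<phi>_def int_mod.representation_diff[OF B(2) yz(2,1)])
      thus ?thesis unfolding c_def by simp
    qed
    have "y - z = (\<Sum>b\<in>B. of_int (?r (y - z) b) * b)"
      using int_mod.sum_representation_eq[OF B(2) int_mod.span_diff[OF yz] B(1) subset_refl] by simp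
    also have "\<dots> = 2 * (\<Sum>b\<in>B. of_int (c b) * b)"
      unfolding sum_distrib_left by (rule sum.cong) (simp_all add: c mult.assoc)
    finally show ?thesis
      by (rule doublesI[rotated])
         (unfold B(3), intro int_mod.span_sum int_mod.span_scale int_mod.span_base)
  qed
  \<comment> \<open>If two such combinations have the same class, their difference lies in
    \<open>doubles\<close>, so by \<open>indep\<close> its coefficients are even and hence zero. An
    injection between power sets of equal size is onto, so the class of \<open>x\<close> is
    attained.\<close>
  have "inj_on (\<lambda>S. \<phi> (s S)) (Pow I)"
  proof (rule inj_onI)
    fix S T assume ST: "S \<in> Pow I" "T \<in> Pow I" "\<phi> (s S) = \<phi> (s T)"
    have "s S - s T = (\<Sum>i\<in>I. of_int (of_bool (i \<in> S) - of_bool (i \<in> T)) * v i)"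
      by (simp add: s_def sum_subtractf[symmetric] algebra_simps)
    with \<phi>[OF sR sR ST(3)]
    have "(\<Sum>i\<in>I. of_int (of_bool (i \<in> S) - of_bool (i \<in> T)) * v i) \<in> doubles" by simp
    from indep[OF this] have "i \<in> S \<longleftrightarrow> i \<in> T" if "i \<in> I" for i
      using that by fastforce
    thus "S = T" using ST by blast
  qed
  moreover have "(\<lambda>S. \<phi> (s S)) ` Pow I \<subseteq> Pow B" by (auto simp: \<phi>_def)
  moreover have "card (Pow I) = card (Pow B)" using I B by (simp add: card_Pow)
  ultimately have "(\<lambda>S. \<phi> (s S)) ` Pow I = Pow B"
    using B(1) by (metis card_image card_subset_eq finite_Pow_iff)
  moreover have "\<phi> x \<in> Pow B" by (auto simp: \<phi>_def)
  ultimately obtain S where "\<phi> x = \<phi> (s S)" by (metis imageE)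
  from \<phi>[OF x sR this] show ?thesis unfolding s_def by (rule that)
qed

end

text \<open>\<open>T\<close> will be the trace. The conditions encode that there are three homomorphisms
  \<open>R \<rightarrow> F\<^sub>2\<close>, with values \<open>(0,0)\<close>, \<open>(1,0)\<close>, \<open>(1,1)\<close> at \<open>(u,w)\<close>, and that \<open>\<theta>\<close> has
  ramification index three at the last two.\<close>

locale three_primes = subring_of_field +
  fixes T :: "'a \<Rightarrow> int" and \<theta> u w :: 'a
  assumes T_add: "x \<in> R \<Longrightarrow> y \<in> R \<Longrightarrow> T (x + y) = T x + T y"
    and T_mult: "x \<in> R \<Longrightarrow> T (of_int k * x) = k * T x"
    and T_square: "x \<in> R \<Longrightarrow> even (T (x\<^sup>2) - T x)"
    and T_1: "odd (T 1)" and T_u: "even (T u)" and T_w: "odd (T w)"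
    and closed': "\<theta> \<in> R" "u \<in> R" "w \<in> R"
    and cube: "\<theta> ^ 3 = 2 * u"
    and u_square: "u\<^sup>2 = u + 2 * w"
    and u_mult_w: "u * w - w \<in> radical"
    and w_square: "w\<^sup>2 - w \<in> radical"
begin

lemma T_doubles: "x \<in> doubles \<Longrightarrow> even (T x)"
  using T_mult[of _ 2] by (auto simp: doubles_def)

text \<open>Repeated squaring preserves the parity of \<open>T\<close>, and some iterated square
  lies in \<open>doubles\<close>, where \<open>T\<close> is even.\<close>

lemma T_radical:
  assumes "x \<in> radical"
  shows "even (T x)"
proof -
  obtain k where k: "x \<in> R" "x ^ 2 ^ k \<in> doubles" using assms by (auto simp: radical_def)
  have "even (T (x ^ 2 ^ k) - T x)"
  proof (induction k)
    case (Suc k)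
    have "even (T ((x ^ 2 ^ k)\<^sup>2) - T (x ^ 2 ^ k))" by (intro T_square power_closed k)
    thus ?case using Suc by (simp add: power_mult[symmetric] mult.commute)
  qed simp
  thus ?thesis using T_doubles[OF k(2)] by simp
qed

lemma u_square': "u\<^sup>2 - u \<in> radical"
  using u_square closed' by (auto intro: doubles_subset_radical doublesI)

text \<open>Modulo the radical, multiplication by \<open>u\<close> yields
  \<open>(i + j) u + k w\<close>, and multiplication by \<open>w\<close> yields
  \<open>(i + j + k) w\<close>. The parity of \<open>T\<close> on the element and on these two
  multiples shows that \<open>i + k\<close>, \<open>k\<close> and \<open>i + j + k\<close> are
  even.\<close>

lemma independent_mod_radical:
  assumes z: "of_int i + of_int j * u + of_int k * w \<in> radical" (is "?z \<in> _")
  shows "even i" "even j" "even k"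
proof -
  have T: "T (of_int i + of_int j * u + of_int k * w) = i * T 1 + j * T u + k * T w" for i j k
    using T_add[of "of_int i * 1 + of_int j * u" "of_int k * w"]
      T_add[of "of_int i * 1" "of_int j * u"] T_mult[OF one_closed, of i] T_mult closed'
    by (simp add: closed)
  have ik: "even (i + k)"
    using T_radical[OF z] T[of i j k] T_1 T_u T_w by simp
  \<comment> \<open>The two terms with factor \<open>of_int i\<close> cancel; the next identity
    drops them.\<close>
  have "u * ?z - (of_int i * (u * u - u) + of_int j * (u\<^sup>2 - u) + of_int k * (u * w - w))
      - of_int i * (u - u * u) = of_int 0 + of_int (i + j) * u + of_int k * w"
    by (simp add: algebra_simps power2_eq_square)
  moreover have "\<dots> = u * ?z - (of_int j * (u\<^sup>2 - u) + of_int k * (u * w - w))"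
    by (simp add: algebra_simps power2_eq_square)
  ultimately have "of_int 0 + of_int (i + j) * u + of_int k * w \<in> radical"
    using z u_square' u_mult_w closed'
    by (auto intro!: radical_diff radical_add radical_mult closed)
  from T_radical[OF this] T[of 0 "i + j" k] have k: "even k" using T_u T_w by simp
  have "of_int 0 + of_int 0 * u + of_int (i + j + k) * w =
      w * ?z - (of_int j * (u * w - w) + of_int k * (w\<^sup>2 - w))"
    by (simp add: algebra_simps power2_eq_square)
  also have "\<dots> \<in> radical"
    using z w_square u_mult_w closed'
    by (auto intro!: radical_diff radical_add radical_mult closed)
  finally have "even (i + j + k)" using T_radical T[of 0 0 "i + j + k"] T_w by fastforce
  with ik k show "even i" "even j" "even k" by auto
qed

lemma theta_radical: "\<theta> \<in> radical"
  using cube closed' by (intro radicalI[of _ 3] doublesI[of u]) auto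

text \<open>The cube of \<open>\<theta>\<^sup>2 x / 2\<close> is \<open>u\<^sup>2 x\<^sup>3 / 2\<close>, which brings the question back to \<open>u\<close> and \<open>w\<close>.\<close>

lemma theta_square_mult:
  assumes x: "\<theta>\<^sup>2 * (of_int i + of_int j * w) \<in> doubles" (is "\<theta>\<^sup>2 * ?x \<in> _")
  shows "even i" "even j"
proof -
  have xR: "?x \<in> R" using closed' by (simp add: closed)
  obtain r where r: "r \<in> R" "\<theta>\<^sup>2 * ?x = 2 * r" using x by (auto simp: doubles_def)
  have "8 * r ^ 3 = (\<theta>\<^sup>2 * ?x) ^ 3" unfolding r(2) by (simp add: power_mult_distrib)
  also have "\<dots> = (\<theta> ^ 3)\<^sup>2 * ?x ^ 3" by (simp add: power_mult_distrib flip: power_mult)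
  also have "\<dots> = 4 * u\<^sup>2 * ?x ^ 3" by (simp add: cube power_mult_distrib)
  finally have "u\<^sup>2 * ?x ^ 3 = 2 * r ^ 3" by simp
  \<comment> \<open>One more factor \<open>u\<close> completes the cube, so that
    \<open>u * ?x\<close> is seen to lie in the radical.\<close>
  hence "(u * ?x) ^ 3 = 2 * (u * r ^ 3)"
    by (simp add: power_mult_distrib power2_eq_square power3_eq_cube mult_ac)
  hence "u * ?x \<in> radical"
    using closed' r xR by (intro radicalI[of _ 3] doublesI[of "u * r ^ 3"]) (auto intro!: closed)
  moreover have "of_int 0 + of_int i * u + of_int j * w = u * ?x - of_int j * (u * w - w)"
    by (simp add: algebra_simps)
  ultimately have "of_int 0 + of_int i * u + of_int j * w \<in> radical"
    using u_mult_w by (auto intro!: radical_diff radical_mult closed)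
  from independent_mod_radical[OF this] show "even i" "even j" by auto
qed

lemma even_combination_in_doubles:
  assumes "even i" "even j"
  shows "of_int i + of_int j * w \<in> doubles"
proof -
  obtain i' j' where "i = 2 * i'" "j = 2 * j'" using assms by (auto elim!: evenE)
  thus ?thesis using closed'
    by (intro doublesI[of "of_int i' + of_int j' * w"]) (auto simp: algebra_simps intro: closed)
qed

text \<open>Coefficients are peeled off along the powers of \<open>\<theta>\<close>. As
  \<open>\<theta>\<close> lies in the radical, the first three are even. Multiplying the rest by
  \<open>\<theta>\<close> pushes the \<open>\<theta>\<^sup>2\<close> part into
  \<open>doubles\<close>, since \<open>\<theta> ^ 3 = 2 * u\<close>, and leaves a case of
  \<open>theta_square_mult\<close>; the last two coefficients are another such case.\<close>

lemma independent_mod_doubles: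
  fixes m :: "nat \<Rightarrow> int"
  assumes "of_int (m 0) + of_int (m 1) * u + of_int (m 2) * w
    + \<theta> * (of_int (m 3) + of_int (m 4) * w) + \<theta>\<^sup>2 * (of_int (m 5) + of_int (m 6) * w) \<in> doubles"
    (is "?e + \<theta> * ?x + \<theta>\<^sup>2 * ?y \<in> _")
  shows "i < 7 \<Longrightarrow> even (m i)"
proof -
  have R: "?x \<in> R" "?y \<in> R" using closed' by (auto intro!: closed)
  have "?e = (?e + \<theta> * ?x + \<theta>\<^sup>2 * ?y) - (?x * \<theta> + (?y * \<theta>) * \<theta>)"
    by (simp add: power2_eq_square algebra_simps)
  also have "\<dots> \<in> radical"
    by (rule radical_diff[OF doubles_subset_radical[OF assms]])
       (intro radical_add radical_mult theta_radical mult_closed R closed')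
  finally have e: "even (m 0)" "even (m 1)" "even (m 2)" using independent_mod_radical by auto
  have "of_int (m 1) * u \<in> doubles"
    using e(2) closed' by (intro doublesI[of "of_int (m 1 div 2) * u"])
      (auto intro: closed elim!: evenE)
  hence "of_int (m 1) * u + (of_int (m 0) + of_int (m 2) * w) \<in> doubles"
    by (rule doubles_add[OF _ even_combination_in_doubles[OF e(1,3)]])
  hence "?e \<in> doubles" by (simp only: ac_simps)
  hence xy: "\<theta> * ?x + \<theta>\<^sup>2 * ?y \<in> doubles"
    using doubles_diff[OF assms] by fastforce
  have "\<theta>\<^sup>2 * ?x = \<theta> * (\<theta> * ?x + \<theta>\<^sup>2 * ?y) - 2 * (u * ?y)"
    unfolding mult.assoc[symmetric] cube[symmetric]
    by (simp add: algebra_simps power2_eq_square power3_eq_cube)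
  also have "\<dots> \<in> doubles"
    by (rule doubles_diff[OF doubles_mult[OF closed'(1) xy]
          doublesI[OF mult_closed[OF closed'(2) R(2)] refl]])
  finally have x: "even (m 3)" "even (m 4)" using theta_square_mult by auto
  have "\<theta> * ?x \<in> doubles" by (intro doubles_mult even_combination_in_doubles x closed')
  with xy have "\<theta>\<^sup>2 * ?y \<in> doubles" using doubles_diff by fastforce
  hence "even (m 5)" "even (m 6)" using theta_square_mult by auto
  moreover assume "i < 7"
  hence "i \<in> {0, 1, 2, 3, 4, 5, 6}" by auto
  ultimately show "even (m i)" using e x by auto
qed

text \<open>The seven elements \<open>v i\<close> are independent modulo \<open>doubles\<close>,
  hence span by counting. Each is idempotent modulo the radical, the multiples of
  \<open>\<theta>\<close> because they lie in it, and such idempotents are closed under integer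
  combinations because \<open>2 R\<close> is in the radical.\<close>

lemma all_idempotent_mod_radical:
  assumes B: "finite B" "int_mod.independent B" "R = int_mod.span B" "card B = 7"
    and x: "x \<in> R"
  shows "x\<^sup>2 - x \<in> radical"
proof -
  define v where "v = (\<lambda>i. [1, u, w, \<theta>, \<theta> * w, \<theta>\<^sup>2, \<theta>\<^sup>2 * w] ! i)"
  have v: "v 0 = 1" "v 1 = u" "v 2 = w" "v 3 = \<theta>" "v 4 = \<theta> * w" "v 5 = \<theta>\<^sup>2" "v 6 = \<theta>\<^sup>2 * w"
    by (simp_all add: v_def)
  have I: "{..<7::nat} = {0, 1, 2, 3, 4, 5, 6}" by auto
  have sum: "(\<Sum>i<7. of_int (m i) * v i) = of_int (m 0) + of_int (m 1) * u + of_int (m 2) * w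
    + \<theta> * (of_int (m 3) + of_int (m 4) * w) + \<theta>\<^sup>2 * (of_int (m 5) + of_int (m 6) * w)" for m
    unfolding I by (simp add: v algebra_simps del: One_nat_def)
  have vR: "v i \<in> R" if "i \<in> {..<7}" for i
    using that closed' unfolding I by (auto simp: v simp del: One_nat_def intro!: closed)
  have vi: "(v i)\<^sup>2 - v i \<in> radical" if "i \<in> {..<7}" for i
  proof -
    have nil: "y\<^sup>2 - y \<in> radical" if "y \<in> radical" for y
      using that by (auto simp: power2_eq_square intro: radical_diff radical_mult radical_subset)
    have "\<theta> * w \<in> radical" "\<theta>\<^sup>2 \<in> radical" "\<theta>\<^sup>2 * w \<in> radical"
      using radical_mult[OF _ theta_radical, of w] radical_mult[OF _ theta_radical, of "\<theta>"]
        radical_mult[OF _ theta_radical, of "\<theta> * w"] closed' closed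
      by (auto simp: mult_ac power2_eq_square)
    thus ?thesis using that u_square' w_square theta_radical unfolding I
      by (auto simp: v radical_zero simp del: One_nat_def intro: nil)
  qed
  obtain m where m: "x - (\<Sum>i<7. of_int (m i) * v i) \<in> doubles"
    by (rule spans_mod_two[OF B(1-3), of "{..<7}" v])
       (use B(4) vR x independent_mod_doubles in \<open>auto simp: sum\<close>)
  have "(\<Sum>i\<in>A. of_int (m i) * v i) \<in> R \<and>
      (\<Sum>i\<in>A. of_int (m i) * v i)\<^sup>2 - (\<Sum>i\<in>A. of_int (m i) * v i) \<in> radical"
    if "finite A" "A \<subseteq> {..<7}" for A
    using that
    by (induction rule: finite_induct)
       (auto intro!: idempotent_add idempotent_of_int_mult vi vR closed simp: radical_zero zero_closed)
  from this[of "{..<7}"]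
  have "(\<Sum>i<7. of_int (m i) * v i) \<in> R"
    "(\<Sum>i<7. of_int (m i) * v i)\<^sup>2 - (\<Sum>i<7. of_int (m i) * v i) \<in> radical" by auto
  moreover define d where "d = x - (\<Sum>i<7. of_int (m i) * v i)"
  have "d \<in> radical" using m by (simp add: d_def doubles_subset_radical)
  hence "d \<in> R" "d\<^sup>2 - d \<in> radical"
    by (auto simp: power2_eq_square intro: radical_diff radical_mult radical_subset)
  ultimately have "((\<Sum>i<7. of_int (m i) * v i) + d)\<^sup>2 - ((\<Sum>i<7. of_int (m i) * v i) + d) \<in> radical"
    by (intro idempotent_add)
  thus ?thesis by (simp add: d_def)
qed

lemma not_power_basis:
  assumes B: "B = (\<lambda>i. \<alpha> ^ i) ` {..<7}" "int_mod.independent B" "R = int_mod.span B" "card B = 7"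
  shows False
proof -
  have fB: "finite B" by (simp add: B)
  have "\<alpha> ^ 1 \<in> B" unfolding B(1) by (rule imageI) simp
  hence \<alpha>: "\<alpha> \<in> R" using B(3) by (simp add: int_mod.span_base)
  \<comment> \<open>As \<open>\<alpha>\<close> is idempotent modulo the radical, all its positive
    powers are congruent to it.\<close>
  have lin: "\<exists>m n. x - (of_int m + of_int n * \<alpha>) \<in> radical" if "x \<in> R" for x
    using that[unfolded B(3)]
  proof (induction rule: int_mod.span_induct_alt)
    case base
    show ?case by (intro exI[of _ 0]) (simp add: radical_zero)
  next
    case (step k y z)
    from step(2) obtain m n where mn: "z - (of_int m + of_int n * \<alpha>) \<in> radical" by blast
    from step(1) obtain i where i: "y = \<alpha> ^ i" by (auto simp: B)
    have "\<exists>m n. y - (of_int m + of_int n * \<alpha>) \<in> radical"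
    proof (cases "i = 0")
      case True
      thus ?thesis using i by (intro exI[of _ 1] exI[of _ 0]) (simp add: radical_zero)
    next
      case False
      hence "\<alpha> ^ i - \<alpha> \<in> radical"
        using idempotent_power[OF \<alpha> all_idempotent_mod_radical[OF fB B(2-4) \<alpha>]] by simp
      thus ?thesis using i by (intro exI[of _ 0] exI[of _ 1]) simp
    qed
    then obtain m' n' where "y - (of_int m' + of_int n' * \<alpha>) \<in> radical" by blast
    hence "of_int k * (y - (of_int m' + of_int n' * \<alpha>)) + (z - (of_int m + of_int n * \<alpha>)) \<in> radical"
      using mn by (intro radical_add radical_mult closed)
    moreover have "of_int k * (y - (of_int m' + of_int n' * \<alpha>)) + (z - (of_int m + of_int n * \<alpha>))
        = of_int k * y + z - (of_int (k * m' + m) + of_int (k * n' + n) * \<alpha>)"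
      by (simp add: algebra_simps)
    ultimately show ?case by metis
  qed
  obtain i j where u: "u - (of_int i + of_int j * \<alpha>) \<in> radical" using lin closed' by blast
  obtain k l where w: "w - (of_int k + of_int l * \<alpha>) \<in> radical" using lin closed' by blast
  \<comment> \<open>Eliminating \<open>\<alpha>\<close> from the two congruences leaves a relation
    between \<open>1\<close>, \<open>u\<close>, \<open>w\<close> in which \<open>w\<close> has
    coefficient \<open>j\<close>. Once \<open>j\<close> is even, \<open>u\<close> is congruent to an
    integer, a relation with the odd coefficient 1 at \<open>u\<close>.\<close>
  have "of_int j * (w - (of_int k + of_int l * \<alpha>)) - of_int l * (u - (of_int i + of_int j * \<alpha>)) \<in> radical"
    by (rule radical_diff[OF radical_mult[OF of_int_closed w] radical_mult[OF of_int_closed u]])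
  moreover have "of_int j * (w - (of_int k + of_int l * \<alpha>)) - of_int l * (u - (of_int i + of_int j * \<alpha>))
      = of_int (l * i - j * k) + of_int (- l) * u + of_int j * w"
    by (simp add: algebra_simps)
  ultimately have "even j" using independent_mod_radical by metis
  then obtain h where h: "j = 2 * h" by (elim evenE)
  have "of_int (- i) + of_int 1 * u + of_int 0 * w = (u - (of_int i + of_int j * \<alpha>)) + 2 * (of_int h * \<alpha>)"
    by (simp add: h algebra_simps)
  also have "\<dots> \<in> radical"
    by (intro radical_add[OF u] doubles_subset_radical doublesI[OF _ refl] closed \<alpha>)
  finally show False using independent_mod_radical(2) by fastforce
qed

end

section \<open>Simple extensions of the rationals\<close>

lemma is_subfield_imp_subring: "is_subfield F \<Longrightarrow> subring_of_field F"
  unfolding is_subfield_def by unfold_locales auto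

lemma is_subfield_of_rat:
  assumes "is_subfield F"
  shows "of_rat q \<in> F"
proof -
  interpret subring_of_field F by (rule is_subfield_imp_subring[OF assms])
  obtain i j where "q = of_int i / of_int j" by (metis Fract_of_int_quotient Rat_cases)
  hence "of_rat q = of_int i * inverse (of_int j :: 'a)"
    by (simp add: of_rat_divide field_simps)
  moreover have "inverse (of_int j) \<in> F"
    using assms of_int_closed unfolding is_subfield_def by blast
  ultimately show ?thesis by (simp add: closed)
qed

definition eval_rat :: "'a::field_char_0 \<Rightarrow> rat poly \<Rightarrow> 'a" where
  "eval_rat \<theta> p = poly (map_poly of_rat p) \<theta>"

lemma eval_rat_add: "eval_rat \<theta> (p + q) = eval_rat \<theta> p + eval_rat \<theta> q"
  and eval_rat_diff: "eval_rat \<theta> (p - q) = eval_rat \<theta> p - eval_rat \<theta> q"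
  and eval_rat_mult: "eval_rat \<theta> (p * q) = eval_rat \<theta> p * eval_rat \<theta> q"
  and eval_rat_0: "eval_rat \<theta> 0 = 0"
  and eval_rat_1: "eval_rat \<theta> 1 = 1"
  for \<theta> :: "'a::field_char_0"
proof -
  interpret map_poly_comm_ring_hom "of_rat :: rat \<Rightarrow> 'a" ..
  show "eval_rat \<theta> (p + q) = eval_rat \<theta> p + eval_rat \<theta> q"
    "eval_rat \<theta> (p - q) = eval_rat \<theta> p - eval_rat \<theta> q"
    "eval_rat \<theta> (p * q) = eval_rat \<theta> p * eval_rat \<theta> q"
    "eval_rat \<theta> 0 = 0" "eval_rat \<theta> 1 = 1"
    by (simp_all add: eval_rat_def hom_distribs)
qed

lemma eval_rat_monom: "eval_rat \<theta> (monom c n) = of_rat c * \<theta> ^ n"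
  by (simp add: eval_rat_def map_poly_monom poly_monom)

lemma eval_rat_sum: "eval_rat \<theta> (\<Sum>i\<in>A. f i) = (\<Sum>i\<in>A. eval_rat \<theta> (f i))"
  by (induction A rule: infinite_finite_induct) (simp_all add: eval_rat_0 eval_rat_add)

lemma eval_rat_altdef:
  assumes "degree p < n"
  shows "eval_rat \<theta> p = (\<Sum>i<n. of_rat (coeff p i) * \<theta> ^ i)"
proof -
  have "p = (\<Sum>i<n. monom (coeff p i) i)"
    using assms by (intro poly_eqI) (auto simp: coeff_sum coeff_eq_0)
  hence "eval_rat \<theta> p = eval_rat \<theta> (\<Sum>i<n. monom (coeff p i) i)" by (rule arg_cong)
  thus ?thesis by (simp add: eval_rat_sum eval_rat_monom)
qed

locale simple_extension =
  fixes f :: "rat poly" and \<theta> :: "'a::field_char_0"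
  assumes irred: "irreducible f" and root: "eval_rat \<theta> f = 0"
begin

definition powers :: "'a set" where
  "powers = (\<lambda>i. \<theta> ^ i) ` {..<degree f}"

lemma degree_pos: "0 < degree f"
proof (rule ccontr)
  assume "\<not> 0 < degree f"
  then obtain c where "f = [:c:]" by (auto elim: degree_eq_zeroE)
  thus False using irred by (auto simp: irreducible_def is_unit_const_poly_iff)
qed

text \<open>Bezout in the polynomial ring; evaluation at \<open>\<theta>\<close> removes the
  multiple of \<open>f\<close>.\<close>

lemma eval_rat_inverse:
  assumes "\<not> f dvd p"
  obtains q where "eval_rat \<theta> q * eval_rat \<theta> p = 1"
proof -
  have "prime_elem f" by (rule field_poly_irreducible_imp_prime[OF irred])
  hence "coprime f p" using assms by (rule prime_elem_imp_coprime)
  hence "fst (bezout_coefficients f p) * f + snd (bezout_coefficients f p) * p = 1"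
    by (simp add: bezout_coefficients_fst_snd)
  from arg_cong[OF this, of "eval_rat \<theta>"] show ?thesis
    using that root by (simp add: eval_rat_add eval_rat_mult eval_rat_1)
qed

lemma eval_rat_mod: "eval_rat \<theta> (p mod f) = eval_rat \<theta> p"
  using arg_cong[OF div_mult_mod_eq[of p f], of "eval_rat \<theta>"]
  unfolding eval_rat_add eval_rat_mult root by simp

lemma degree_mod: "degree (p mod f) < degree f"
proof -
  have "f \<noteq> 0" using degree_pos by auto
  thus ?thesis using degree_pos degree_mod_less[of f p] by auto
qed

text \<open>By \<open>eval_rat_inverse\<close> the values of polynomials at \<open>\<theta>\<close>
  are closed under inverses, so they already form a field.\<close>

lemma rat_adjoin_eq: "rat_adjoin \<theta> = range (eval_rat \<theta>)"
proof
  have "is_subfield (range (eval_rat \<theta>))"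
    unfolding is_subfield_def
  proof (intro conjI ballI)
    show "1 \<in> range (eval_rat \<theta>)" by (metis eval_rat_1 rangeI)
    fix x assume "x \<in> range (eval_rat \<theta>)"
    then obtain p where p: "x = eval_rat \<theta> p" by blast
    show "inverse x \<in> range (eval_rat \<theta>)"
    proof (cases "x = 0")
      case True
      thus ?thesis by (metis eval_rat_0 inverse_zero rangeI)
    next
      case False
      hence "\<not> f dvd p" using root by (auto simp: p eval_rat_mult elim!: dvdE)
      then obtain q where "eval_rat \<theta> q * x = 1" using eval_rat_inverse p by blast
      hence "inverse x = eval_rat \<theta> q" using inverse_unique by (metis mult.commute)
      thus ?thesis by simp
    qed
    fix y assume "y \<in> range (eval_rat \<theta>)"
    then obtain q where q: "y = eval_rat \<theta> q" by blast
    show "x - y \<in> range (eval_rat \<theta>)" "x * y \<in> range (eval_rat \<theta>)"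
      unfolding p q by (metis eval_rat_diff eval_rat_mult rangeI)+
  qed
  moreover have "\<theta> \<in> range (eval_rat \<theta>)"
    using eval_rat_monom[of \<theta> 1 1] by (metis mult_1 of_rat_1 power_one_right rangeI)
  ultimately show "rat_adjoin \<theta> \<subseteq> range (eval_rat \<theta>)"
    unfolding rat_adjoin_def by blast
  show "range (eval_rat \<theta>) \<subseteq> rat_adjoin \<theta>"
  proof (clarsimp simp: rat_adjoin_def)
    fix p F assume F: "is_subfield F" "\<theta> \<in> F"
    interpret subring_of_field F by (rule is_subfield_imp_subring[OF F(1)])
    show "eval_rat \<theta> p \<in> F"
      unfolding eval_rat_altdef[OF lessI]
      by (intro sum_closed mult_closed power_closed is_subfield_of_rat F)
  qed
qed

lemma subfield_rat_adjoin: "is_subfield (rat_adjoin \<theta>)"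
  unfolding rat_adjoin_def is_subfield_def by blast

lemma span_powers: "rat_vs.span powers = rat_adjoin \<theta>"
proof
  show "rat_vs.span powers \<subseteq> rat_adjoin \<theta>"
  proof
    fix x assume "x \<in> rat_vs.span powers"
    thus "x \<in> rat_adjoin \<theta>"
    proof (induction rule: rat_vs.span_induct_alt)
      case base
      show ?case unfolding rat_adjoin_eq by (metis eval_rat_0 rangeI)
    next
      case (step c y z)
      then obtain i p where "y = \<theta> ^ i" "z = eval_rat \<theta> p"
        by (auto simp: powers_def rat_adjoin_eq)
      hence "of_rat c * y + z = eval_rat \<theta> (monom c i + p)"
        by (simp add: eval_rat_add eval_rat_monom)
      thus ?case by (simp add: rat_adjoin_eq)
    qed
  qed
  show "rat_adjoin \<theta> \<subseteq> rat_vs.span powers"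
  proof
    fix x assume "x \<in> rat_adjoin \<theta>"
    then obtain p where "x = eval_rat \<theta> p" by (auto simp: rat_adjoin_eq)
    hence "x = (\<Sum>i<degree f. of_rat (coeff (p mod f) i) * \<theta> ^ i)"
      using eval_rat_altdef[OF degree_mod] eval_rat_mod by metis
    thus "x \<in> rat_vs.span powers"
      by (auto simp: powers_def intro!: rat_vs.span_sum rat_vs.span_scale intro: rat_vs.span_base)
  qed
qed

text \<open>A nonzero polynomial of degree below that of \<open>f\<close> is not divisible by
  \<open>f\<close>, so its value is invertible. Indexing by exponents instead of elements of
  \<open>powers\<close> lets this also prove that the powers are distinct.\<close>

lemma powers_independent:
  assumes "(\<Sum>i<degree f. of_rat (c i) * \<theta> ^ i) = 0" "i < degree f"
  shows "c i = 0"
proof -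
  define p where "p = (\<Sum>i<degree f. monom (c i) i)"
  have coeff: "coeff p j = (if j < degree f then c j else 0)" for j
    by (simp add: p_def coeff_sum)
  have p: "eval_rat \<theta> p = 0" using assms by (simp add: p_def eval_rat_sum eval_rat_monom)
  have "p = 0"
  proof (rule ccontr)
    assume "p \<noteq> 0"
    have "degree p < degree f"
      using degree_pos by (intro degree_lessI) (auto simp: coeff)
    with \<open>p \<noteq> 0\<close> have "\<not> f dvd p" using dvd_imp_degree_le leD by blast
    then obtain q where "eval_rat \<theta> q * eval_rat \<theta> p = 1" by (rule eval_rat_inverse)
    thus False using p by simp
  qed
  thus ?thesis using coeff[of i] assms(2) by simp
qed

lemma inj_on_powers: "inj_on (\<lambda>i. \<theta> ^ i) {..<degree f}"
proof (rule inj_onI)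
  fix i j assume ij: "i \<in> {..<degree f}" "j \<in> {..<degree f}" "\<theta> ^ i = \<theta> ^ j"
  \<comment> \<open>If \<open>i\<close> and \<open>j\<close> differed, this relation would have
    coefficient 1 at \<open>i\<close>.\<close>
  have "(\<Sum>k<degree f. of_rat (of_bool (k = i) - of_bool (k = j)) * \<theta> ^ k) = 0"
  proof -
    have "of_rat (of_bool (k = i) - of_bool (k = j)) * \<theta> ^ k
        = (if k = i then \<theta> ^ k else 0) - (if k = j then \<theta> ^ k else 0)" for k
      by simp
    thus ?thesis using ij by (simp add: sum_subtractf)
  qed
  from powers_independent[OF this, of i] ij show "i = j" by (auto split: if_splits)
qed

lemma finite_powers: "finite powers"
  by (simp add: powers_def)

lemma independent_powers: "rat_vs.independent powers"
proof (rule rat_vs.independent_if_scalars_zero[OF finite_powers])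
  fix c x assume c: "(\<Sum>x\<in>powers. of_rat (c x) * x) = 0" and "x \<in> powers"
  then obtain i where "x = \<theta> ^ i" "i < degree f" by (auto simp: powers_def)
  moreover have "(\<Sum>i<degree f. of_rat (c (\<theta> ^ i)) * \<theta> ^ i) = 0"
    using c unfolding powers_def by (simp add: sum.reindex[OF inj_on_powers])
  ultimately show "c x = 0" using powers_independent[of "\<lambda>i. c (\<theta> ^ i)"] by simp
qed

lemma degree_rat_adjoin: "field_degree (rat_adjoin \<theta>) = degree f"
proof -
  have "rat_vs.dim (rat_vs.span powers) = card powers"
    by (rule rat_vs.dim_span_eq_card_independent[OF independent_powers])
  thus ?thesis
    by (simp add: field_degree_def span_powers) (simp add: powers_def card_image[OF inj_on_powers])
qed

lemma representation_powers:
  assumes "i < degree f"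
  shows "rat_vs.representation powers (\<Sum>j<degree f. of_rat (c j) * \<theta> ^ j) (\<theta> ^ i) = c i"
proof -
  let ?x = "\<Sum>j<degree f. of_rat (c j) * \<theta> ^ j" and ?r = "rat_vs.representation powers"
  have "?x \<in> rat_vs.span powers"
    by (auto simp: powers_def intro!: rat_vs.span_sum rat_vs.span_scale intro: rat_vs.span_base)
  hence "(\<Sum>b\<in>powers. of_rat (?r ?x b) * b) = ?x"
    by (intro rat_vs.sum_representation_eq independent_powers finite_powers subset_refl)
  hence "(\<Sum>j<degree f. of_rat (?r ?x (\<theta> ^ j)) * \<theta> ^ j) = ?x"
    \<comment> \<open>Only the index set of the sum is rewritten; \<open>powers\<close> inside the
      representation stays folded.\<close>
    unfolding powers_def[THEN arg_cong, of "sum _"] by (simp add: sum.reindex[OF inj_on_powers])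
  hence "(\<Sum>j<degree f. of_rat (?r ?x (\<theta> ^ j) - c j) * \<theta> ^ j) = 0"
    by (simp add: of_rat_diff left_diff_distrib sum_subtractf)
  from powers_independent[OF this assms] show ?thesis by simp
qed

lemma rat_trace_powers:
  assumes "\<And>i. i < degree f \<Longrightarrow> y * \<theta> ^ i = (\<Sum>j<degree f. of_rat (M i j) * \<theta> ^ j)"
  shows "rat_trace powers y = (\<Sum>i<degree f. M i i)"
proof -
  have "rat_trace powers y = (\<Sum>i<degree f. rat_vs.representation powers (y * \<theta> ^ i) (\<theta> ^ i))"
    unfolding rat_trace_def powers_def[THEN arg_cong, of "sum _"]
    by (simp add: sum.reindex[OF inj_on_powers])
  also have "\<dots> = (\<Sum>i<degree f. M i i)"
    by (intro sum.cong refl) (simp add: assms representation_powers)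
  finally show ?thesis .
qed

end

section \<open>The trinomial\<close>

text \<open>The equations found for \<open>u\<close> and for \<open>w\<close> both have this shape.
  It is monic of degree 7, since the remaining terms have degree at most 3.\<close>

lemma algebraic_int_if_cubed_quadratic:
  fixes x :: "'a::field_char_0" and q0 q1 r0 r1 r2 r3 :: int
  assumes "x * (x\<^sup>2 + of_int q1 * x + of_int q0) ^ 3
    + of_int r3 * x ^ 3 + of_int r2 * x\<^sup>2 + of_int r1 * x + of_int r0 = 0"
  shows "algebraic_int x"
proof -
  interpret map_poly_comm_ring_hom "of_int :: int \<Rightarrow> 'a" ..
  define q where "q = [:q0, q1, 1:]"
  define r where "r = [:r0, r1, r2, r3:]"
  have q: "degree q = 2" "lead_coeff q = 1" "q \<noteq> 0" by (simp_all add: q_def)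
  have deg: "degree ([:0, 1:] * q ^ 3) = 7"
    using q by (simp add: degree_mult_eq degree_power_eq)
  have "degree r < 7" by (simp add: r_def)
  hence "lead_coeff (r + [:0, 1:] * q ^ 3) = lead_coeff ([:0, 1:] * q ^ 3)"
    by (intro lead_coeff_add_le) (simp only: deg)
  also have "\<dots> = 1" using q by (simp add: lead_coeff_mult lead_coeff_power del: mult_pCons_left)
  finally have monic: "lead_coeff (r + [:0, 1:] * q ^ 3) = 1" .
  have "poly (map_poly of_int q) x = x\<^sup>2 + of_int q1 * x + of_int q0"
    by (simp add: q_def algebra_simps power2_eq_square)
  moreover have "poly (map_poly of_int r) x
      = of_int r3 * x ^ 3 + of_int r2 * x\<^sup>2 + of_int r1 * x + of_int r0"
    by (simp add: r_def of_int_hom.map_poly_pCons_hom algebra_simps power2_eq_square power3_eq_cube)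
  ultimately have "poly (map_poly of_int (r + [:0, 1:] * q ^ 3)) x = 0"
    using assms by (simp add: hom_distribs add_ac del: mult_pCons_left)
  with monic show ?thesis
    unfolding algebraic_int_altdef_ipoly by blast
qed

lemma subring_ring_of_integers:
  assumes "is_subfield K"
  shows "subring_of_field (ring_of_integers K)"
proof
  interpret K: subring_of_field K by (rule is_subfield_imp_subring[OF assms])
  show "1 \<in> ring_of_integers K"
    by (simp add: ring_of_integers_def K.one_closed int_imp_algebraic_int)
  fix x y assume "x \<in> ring_of_integers K" "y \<in> ring_of_integers K"
  thus "x - y \<in> ring_of_integers K" "x * y \<in> ring_of_integers K"
    using algebraic_int_add[of x "- y"] algebraic_int_mult[of x y] K.diff_closed K.mult_closed
    by (auto simp: ring_of_integers_def)
qed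

text \<open>With \<open>u = 2 t + 1\<close> and \<open>w = t (2 t + 1)\<close> the relation becomes a septic equation for \<open>t\<close>.
  The septic polynomial for \<open>w\<close> is the norm of that equation over the field generated by \<open>w\<close>, where
  the conjugate of \<open>t\<close> is \<open>- 1/2 - t\<close>.\<close>

lemma algebraic_int_half_product:
  fixes u w :: "'a::field_char_0" and B c :: int
  assumes rel: "u * (u\<^sup>2 - of_int (1 + 4 * B)) ^ 3 = - 256 * of_int c ^ 3"
    and w: "u\<^sup>2 = u + 2 * w"
  shows "algebraic_int w"
proof -
  define t where "t = (u - 1) / 2"
  have u: "u = 2 * t + 1" by (simp add: t_def field_simps)
  have "2 * w = 2 * (2 * t\<^sup>2 + t)" using w by (simp add: u power2_eq_square algebra_simps)
  hence w: "w = 2 * t\<^sup>2 + t" by (metis mult_cancel_left zero_neq_numeral)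
  define b d where "b = (of_int B :: 'a)" and "d = (of_int c :: 'a)"
  have "u\<^sup>2 - of_int (1 + 4 * B) = 4 * (t\<^sup>2 + t - b)"
    by (simp add: u b_def power2_eq_square algebra_simps)
  with rel have "(2 * t + 1) * (4 * (t\<^sup>2 + t - b)) ^ 3 = - 256 * d ^ 3"
    by (simp only: u d_def)
  hence "64 * ((2 * t + 1) * (t\<^sup>2 + t - b) ^ 3 + 4 * d ^ 3) = 0"
    unfolding power_mult_distrib by simp
  hence F: "(2 * t + 1) * (t\<^sup>2 + t - b) ^ 3 + 4 * d ^ 3 = 0"
    by (metis mult_eq_0_iff zero_neq_numeral)
  \<comment> \<open>The conjugation \<open>t \<mapsto> - 1/2 - t\<close> fixes \<open>w\<close> and
    sends \<open>E\<close> to \<open>G / 4\<close> and \<open>2 * t + 1\<close> to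
    \<open>- 2 * t\<close>. Hence \<open>t * G ^ 3 - 128 * d ^ 3\<close> is -32 times the conjugate
    of the left-hand side of \<open>F\<close>.\<close>
  define E G where "E = t\<^sup>2 + t - b" and "G = 4 * t\<^sup>2 - 4 * b - 1"
  have quadratic: "w\<^sup>2 + - (4 * b + 1) * w + (4 * b\<^sup>2 + b) = E * G"
    by (simp add: w E_def G_def power2_eq_square algebra_simps)
  \<comment> \<open>The cross term of the norm is invariant under the conjugation, so it is a
    polynomial in \<open>w\<close>.\<close>
  have cubic: "- 112 * w ^ 3 + (480 * b + 8) * w\<^sup>2 + (- 576 * b\<^sup>2 - 48 * b - 4) * w + 128 * b ^ 3
      = 4 * t * G ^ 3 - 128 * (2 * t + 1) * E ^ 3"
    by (simp add: w E_def G_def power2_eq_square power3_eq_cube algebra_simps)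
  have "w * (E * G) ^ 3 = (2 * t + 1) * E ^ 3 * (t * G ^ 3)"
    by (simp add: w power2_eq_square power_mult_distrib algebra_simps)
  moreover have "d ^ 6 = d ^ 3 * d ^ 3" by (simp flip: power_add)
  ultimately have "w * (E * G) ^ 3 + d ^ 3 * (- 112 * w ^ 3 + (480 * b + 8) * w\<^sup>2
        + (- 576 * b\<^sup>2 - 48 * b - 4) * w + 128 * b ^ 3) - 512 * d ^ 6
      = ((2 * t + 1) * E ^ 3 + 4 * d ^ 3) * (t * G ^ 3 - 128 * d ^ 3)"
    unfolding cubic by (simp add: algebra_simps)
  also have "\<dots> = 0" using F by (simp add: E_def)
  finally have "w * (w\<^sup>2 + - (4 * b + 1) * w + (4 * b\<^sup>2 + b)) ^ 3 + - 112 * d ^ 3 * w ^ 3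
      + (480 * b * d ^ 3 + 8 * d ^ 3) * w\<^sup>2
      + (- 576 * b\<^sup>2 * d ^ 3 - 48 * b * d ^ 3 - 4 * d ^ 3) * w + (128 * b ^ 3 * d ^ 3 - 512 * d ^ 6) = 0"
    unfolding quadratic by (simp add: algebra_simps)
  thus ?thesis
    by (intro algebraic_int_if_cubed_quadratic[of w "- (4 * B + 1)" "4 * B\<^sup>2 + B" "- 112 * c ^ 3"
          "480 * B * c ^ 3 + 8 * c ^ 3" "- 576 * B\<^sup>2 * c ^ 3 - 48 * B * c ^ 3 - 4 * c ^ 3"
          "128 * B ^ 3 * c ^ 3 - 512 * c ^ 6"])
       (simp add: b_def d_def)
qed

text \<open>Since \<open>2 * w = u * (u - 1)\<close>, multiplying \<open>rel\<close> by
  \<open>u - 1\<close> and cancelling a 2 shows that \<open>w * (u - 1)\<close> is in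
  \<open>2 R\<close>. Multiplying \<open>rel\<close> by \<open>u ^ 6\<close> and cancelling 64 gives
  an equation from which the cube of \<open>w\<^sup>2 + w\<close> is in \<open>2 R\<close>.\<close>

lemma (in subring_of_field) radical_relations:
  fixes k c :: int
  assumes R: "u \<in> R" "w \<in> R" and w: "u\<^sup>2 = u + 2 * w"
    and rel: "u * (u\<^sup>2 - of_int (1 - 8 * k)) ^ 3 = - 256 * of_int c ^ 3"
  shows "u * w - w \<in> radical" "w\<^sup>2 - w \<in> radical"
proof -
  define K C where "K = (of_int k :: 'a)" and "C = (of_int c :: 'a)"
  have [simp]: "K \<in> R" "C \<in> R" by (auto simp: K_def C_def closed)
  have rel: "u * (u\<^sup>2 - (1 - 8 * K)) ^ 3 = - 256 * C ^ 3"
    using rel by (simp add: K_def C_def)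
  define v d where "v = u - 1" and "d = w + 4 * K"
  have vd [simp]: "v \<in> R" "d \<in> R" using R by (auto simp: v_def d_def intro!: closed)
  define s where "s = w * v - w + 3 * v\<^sup>2 * d + 6 * v * d\<^sup>2 + 4 * d ^ 3"
  have "s \<in> R" using R by (auto simp: s_def intro!: closed)
  have "u\<^sup>2 - (1 - 8 * K) = v + 2 * d"
    using w by (simp add: v_def d_def)
  \<comment> \<open>The last factor vanishes, so \<open>v ^ 3\<close> is congruent to
    \<open>v\<close> modulo \<open>2 R\<close>.\<close>
  moreover have "v ^ 3 - (v - 2 * w + 2 * w * v) = (u - 2) * (u\<^sup>2 - (u + 2 * w))"
    by (simp add: v_def power2_eq_square power3_eq_cube algebra_simps)
  hence "v ^ 3 = v - 2 * w + 2 * w * v" by (simp add: w)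
  moreover have "(v + 2 * d) ^ 3 = v ^ 3 + 2 * (3 * v\<^sup>2 * d + 6 * v * d\<^sup>2 + 4 * d ^ 3)"
    by (simp add: power2_eq_square power3_eq_cube algebra_simps)
  ultimately have "(u\<^sup>2 - (1 - 8 * K)) ^ 3 = v + 2 * s"
    by (simp add: s_def algebra_simps)
  moreover have "2 * w = u * v" using w by (simp add: v_def power2_eq_square algebra_simps)
  hence "(2 * w) * (u\<^sup>2 - (1 - 8 * K)) ^ 3 = v * (u * (u\<^sup>2 - (1 - 8 * K)) ^ 3)"
    by (simp only: mult_ac)
  hence "2 * (w * (u\<^sup>2 - (1 - 8 * K)) ^ 3) = 2 * (- 128 * C ^ 3 * v)"
    by (simp add: rel)
  ultimately have "w * (v + 2 * s) = - 128 * C ^ 3 * v" by simp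
  hence wv: "w * v = 2 * (- 64 * C ^ 3 * v - w * s)" by (simp add: algebra_simps)
  define e where "e = - 64 * C ^ 3 * v - w * s"
  have e: "u * w = w + 2 * e" "e \<in> R"
    using wv R \<open>s \<in> R\<close> by (auto simp: e_def v_def algebra_simps intro!: closed)
  hence "u * w - w = 2 * e" by simp
  thus "u * w - w \<in> radical" using e(2) by (intro doubles_subset_radical doublesI)
  \<comment> \<open>\<open>h\<close> differs from \<open>w\<^sup>2 - w\<close> by
    \<open>2 * w\<close>; it arises because \<open>u\<^sup>2\<close> times the quadratic factor of
    \<open>rel\<close> equals \<open>4 * (h + 2 * m)\<close>.\<close>
  define h m where "h = w\<^sup>2 + w" and "m = e + K * u\<^sup>2"
  have hm: "h \<in> R" "m \<in> R" using R e by (auto simp: h_def m_def intro!: closed)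
  have "u\<^sup>2 * (u\<^sup>2 - (1 - 8 * K)) = u\<^sup>2 * u\<^sup>2 - u\<^sup>2 + 8 * K * u\<^sup>2"
    by (simp add: algebra_simps)
  also have "u\<^sup>2 * u\<^sup>2 = (u + 2 * w) * (u + 2 * w)" by (simp only: w)
  also have "(u + 2 * w) * (u + 2 * w) - u\<^sup>2 + 8 * K * u\<^sup>2 = 4 * (u * w + w\<^sup>2 + 2 * K * u\<^sup>2)"
    by (simp add: power2_eq_square algebra_simps)
  also have "\<dots> = 4 * (h + 2 * m)"
    unfolding e(1) by (simp add: h_def m_def algebra_simps)
  finally have "u * (4 * (h + 2 * m)) ^ 3 = u * (u\<^sup>2 * (u\<^sup>2 - (1 - 8 * K))) ^ 3" by simp
  also have "\<dots> = u ^ 6 * (u * (u\<^sup>2 - (1 - 8 * K)) ^ 3)"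
    by (simp add: power_mult_distrib flip: power_mult)
  finally have "4 ^ 3 * (u * (h + 2 * m) ^ 3) = 4 ^ 3 * (- 4 * C ^ 3 * u ^ 6)"
    unfolding rel power_mult_distrib by simp
  hence G: "u * (h + 2 * m) ^ 3 = - 4 * C ^ 3 * u ^ 6"
    by (metis mult_cancel_left power_eq_0_iff zero_neq_numeral)
  \<comment> \<open>\<open>h\<close> is a multiple of \<open>w\<close>, and multiplication by
    \<open>u\<close> fixes \<open>w\<close> modulo \<open>2 R\<close>.\<close>
  have "u * h = (u * w) * (w + 1)"
    by (simp add: h_def power2_eq_square algebra_simps)
  hence uh: "u * h = h + 2 * e * (w + 1)"
    unfolding e(1) by (simp add: h_def power2_eq_square algebra_simps)
  have "u * (h + 2 * m) ^ 3
      = (u * h) * h\<^sup>2 + 2 * (u * (3 * h\<^sup>2 * m + 6 * h * m\<^sup>2 + 4 * m ^ 3))"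
    by (simp add: power2_eq_square power3_eq_cube algebra_simps)
  also have "(u * h) * h\<^sup>2 = h ^ 3 + 2 * e * (w + 1) * h\<^sup>2"
    unfolding uh by (simp add: power2_eq_square power3_eq_cube algebra_simps)
  finally have "h ^ 3 = 2 * (- 2 * C ^ 3 * u ^ 6 - e * (w + 1) * h\<^sup>2
      - u * (3 * h\<^sup>2 * m + 6 * h * m\<^sup>2 + 4 * m ^ 3))"
    using G by (simp add: algebra_simps)
  hence "h ^ 3 \<in> doubles"
    by (rule doublesI[rotated]) (use R e hm in \<open>auto intro!: closed\<close>)
  hence "h \<in> radical" by (rule radicalI[OF hm(1)])
  hence "h - 2 * w \<in> radical"
    by (rule radical_diff[OF _ doubles_subset_radical[OF doublesI[OF R(2) refl]]])
  thus "w\<^sup>2 - w \<in> radical" by (simp add: h_def)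
qed

lemma lessThan_7: "{..<7::nat} = {0, 1, 2, 3, 4, 5, 6}"
  by auto

theorem corollary1p3:
  fixes a b :: int and \<theta> :: "'a::field_char_0" and K :: "'a set"
  assumes "irreducible (monom 1 7 + monom (of_int a) 1 + monom (of_int b) 0 :: rat poly)"
    and "\<theta> ^ 7 + of_int a * \<theta> + of_int b = 0"
    and "K = rat_adjoin \<theta>"
    and "32 dvd (a + 4)" and "32 dvd b"
  shows "\<not> monogenic K"
proof
  assume "monogenic K"
  define f :: "rat poly" where "f = monom 1 7 + monom (of_int a) 1 + monom (of_int b) 0"
  have f: "f = [:of_int b, of_int a, 0, 0, 0, 0, 0, 1:]"
    by (simp add: f_def monom_altdef numeral_eq_Suc)
  interpret simple_extension f \<theta>
  proof
    show "irreducible f" using assms(1) by (simp add: f_def)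
    show "eval_rat \<theta> f = 0"
      using assms(2) by (simp add: f_def eval_rat_add eval_rat_monom)
  qed
  have deg: "degree f = 7" by (simp add: f)
  obtain k where "a + 4 = 32 * k" using assms(4) by (elim dvdE)
  hence k: "a = 32 * k - 4" by simp
  obtain c where c: "b = 32 * c" using assms(5) by (elim dvdE)
  define u w where "u = \<theta> ^ 3 / 2" and "w = (u\<^sup>2 - u) / 2"
  have cube: "\<theta> ^ 3 = 2 * u" by (simp add: u_def)
  have w: "u\<^sup>2 = u + 2 * w" by (simp add: w_def field_simps)
  have pow7: "\<theta> ^ 7 = of_int (4 - 32 * k) * \<theta> - of_int (32 * c)"
    using assms(2) by (simp add: k c algebra_simps)
  \<comment> \<open>The septic equation becomes \<open>\<theta>\<close> times a polynomial in
    \<open>u\<close> equal to an integer. Cubing it replaces \<open>\<theta> ^ 3\<close> by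
    \<open>2 * u\<close> and leaves a relation for \<open>u\<close> alone.\<close>
  have "4 * (\<theta> * u\<^sup>2) = \<theta> * (2 * u)\<^sup>2" by (simp add: power_mult_distrib)
  also have "\<dots> = \<theta> ^ 7" by (simp flip: cube power_mult power_Suc)
  finally have "4 * (\<theta> * u\<^sup>2) = \<theta> ^ 7" .
  hence "4 * (\<theta> * (u\<^sup>2 - of_int (1 - 8 * k))) = 4 * (- 8 * of_int c)"
    unfolding pow7 by (simp add: algebra_simps)
  hence "\<theta> * (u\<^sup>2 - of_int (1 - 8 * k)) = - 8 * of_int c" by simp
  hence "\<theta> ^ 3 * (u\<^sup>2 - of_int (1 - 8 * k)) ^ 3 = (- 8 * of_int c) ^ 3"
    by (simp flip: power_mult_distrib)
  hence "2 * (u * (u\<^sup>2 - of_int (1 - 8 * k)) ^ 3) = 2 * (- 256 * of_int c ^ 3)"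
    unfolding cube by (simp add: power_mult_distrib)
  hence rel: "u * (u\<^sup>2 - of_int (1 - 8 * k)) ^ 3 = - 256 * of_int c ^ 3" by simp

  define R where "R = ring_of_integers K"
  have K: "is_subfield K" using subfield_rat_adjoin by (simp add: assms(3))
  interpret K: subring_of_field K by (rule is_subfield_imp_subring[OF K])
  interpret R: subring_of_field R unfolding R_def by (rule subring_ring_of_integers[OF K])
  have \<theta>K: "\<theta> \<in> K" by (auto simp: assms(3) rat_adjoin_def)
  have half: "x / 2 \<in> K" if "x \<in> K" for x
    using K.mult_closed[OF is_subfield_of_rat[OF K, of "1/2"] that] by (simp add: of_rat_divide)
  have uK: "u \<in> K" unfolding u_def by (intro half K.power_closed \<theta>K)
  have wK: "w \<in> K" unfolding w_def by (intro half K.diff_closed K.power_closed uK)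
  have "algebraic_int \<theta>"
    unfolding algebraic_int_altdef_ipoly
    using assms(2) by (intro exI[of _ "[:b, a, 0, 0, 0, 0, 0, 1:]"])
      (simp add: eval_nat_numeral algebra_simps)
  hence \<theta>R: "\<theta> \<in> R" using \<theta>K by (simp add: R_def ring_of_integers_def)
  have "algebraic_int u"
    using rel by (intro algebraic_int_if_cubed_quadratic[of u 0 "8 * k - 1" 0 0 0 "256 * c ^ 3"])
      (simp add: algebra_simps)
  hence uR: "u \<in> R" using uK by (simp add: R_def ring_of_integers_def)
  have "algebraic_int w"
    using rel w by (intro algebraic_int_half_product[of u "- 2 * k" c w]) simp_all
  hence wR: "w \<in> R" using wK by (simp add: R_def ring_of_integers_def)

  obtain \<alpha> where \<alpha>: "is_int_basis ((\<lambda>i. \<alpha> ^ i) ` {..<7}) R"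
    using \<open>monogenic K\<close> degree_rat_adjoin deg
    unfolding monogenic_def R_def assms(3) by auto
  define B where "B = (\<lambda>i. \<alpha> ^ i) ` {..<7::nat}"
  have indB: "int_mod.independent B" and spB: "R = int_mod.span B"
    using \<alpha> by (auto simp: is_int_basis_def B_def)
  \<comment> \<open>The powers of \<open>\<alpha>\<close> might still coincide here; equality will
    come from the dimension of \<open>K\<close>.\<close>
  have finB: "finite B" and cardB: "card B \<le> 7"
    using card_image_le[of "{..<7::nat}" "\<lambda>i. \<alpha> ^ i"] by (auto simp: B_def)
  have int_rat_span: "x \<in> rat_vs.span B" if "x \<in> int_mod.span B" for x
    using that
  proof (induction rule: int_mod.span_induct_alt)
    case (step j y z)
    show ?case
      using rat_vs.span_add[OF rat_vs.span_scale[OF rat_vs.span_base[OF step(1)], of "of_int j"] step(2)]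
      by simp
  qed (simp add: rat_vs.span_zero)
  have spanB: "rat_vs.span B = K"
  proof
    have "B \<subseteq> K" using spB int_mod.span_base[of _ B] by (auto simp: R_def ring_of_integers_def)
    thus "rat_vs.span B \<subseteq> K"
      using rat_vs.span_mono[of B K] rat_vs.span_span[of powers]
      by (simp add: assms(3) flip: span_powers)
    have "powers \<subseteq> rat_vs.span B"
      using int_rat_span R.power_closed[OF \<theta>R] by (auto simp: powers_def spB)
    thus "K \<subseteq> rat_vs.span B"
      unfolding assms(3) span_powers[symmetric] by (metis rat_vs.span_mono rat_vs.span_span)
  qed
  have dimK: "rat_vs.dim K = 7"
    using degree_rat_adjoin by (simp add: assms(3) field_degree_def deg)
  \<comment> \<open>\<open>R\<close> contains the powers of \<open>\<theta>\<close>, so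
    \<open>B\<close> spans \<open>K\<close> over the rationals. A maximal independent subset then
    has seven elements and must be all of \<open>B\<close>.\<close>
  obtain B' where B': "B' \<subseteq> B" "rat_vs.independent B'" "B \<subseteq> rat_vs.span B'"
    by (rule rat_vs.maximal_independent_subset)
  have "rat_vs.span B' = rat_vs.span B"
    using B' by (metis rat_vs.span_mono rat_vs.span_span subset_antisym)
  hence "card B' = 7"
    using rat_vs.dim_span_eq_card_independent[OF B'(2)] spanB dimK by simp
  with cardB finB B'(1) have "B' = B" by (metis card_seteq)
  hence ratB: "rat_vs.independent B" and card7: "card B = 7" using B' \<open>card B' = 7\<close> by auto

  have RB: "x * y \<in> int_mod.span B" if "x \<in> R" "y \<in> B" for x y
    using R.mult_closed[OF that(1)] int_mod.span_base[OF that(2)] by (simp add: spB)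
  have trace: "of_int (int_trace B y) = (\<Sum>i<7. M i i)"
    if "y \<in> R" "\<And>i. i < 7 \<Longrightarrow> y * \<theta> ^ i = (\<Sum>j<7. of_rat (M i j) * \<theta> ^ j)" for y M
  proof -
    have "of_int (int_trace B y) = rat_trace B y"
      using that by (intro of_int_int_trace indB ratB RB)
    also have "\<dots> = rat_trace powers y"
    proof (rule rat_trace_basis_independent[OF finB ratB finite_powers independent_powers])
      show "rat_vs.span B = rat_vs.span powers" by (simp add: spanB span_powers assms(3))
      show "y * x \<in> rat_vs.span B" if "x \<in> rat_vs.span B" for x
        using that \<open>y \<in> R\<close> K.mult_closed by (simp add: spanB R_def ring_of_integers_def)
    qed
    also have "\<dots> = (\<Sum>i<7. M i i)"
      using rat_trace_powers[of y M] that(2) by (simp add: deg)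
    finally show ?thesis .
  qed
  have "of_int (int_trace B 1) = (\<Sum>i<7::nat. of_bool (i = i) :: rat)"
    by (rule trace[OF R.one_closed]) (simp add: of_bool_def if_distrib if_distribR cong: if_cong)
  hence T1: "int_trace B 1 = 7" by simp
  \<comment> \<open>Coordinates of \<open>\<theta> ^ n\<close> in the powers of
    \<open>\<theta>\<close>. For \<open>n = m + 7\<close> with \<open>m \<le> 5\<close>, a single
    use of \<open>pow7\<close> leaves only the exponents \<open>m + 1\<close> and \<open>m\<close>.
    The trace of \<open>w\<close> needs \<open>n\<close> up to 12.\<close>
  define row :: "nat \<Rightarrow> nat \<Rightarrow> rat" where
    "row n j = (if n < 7 then if j = n then 1 else 0
      else (if j = n - 6 then of_int (4 - 32 * k) else 0) - (if j = n - 7 then of_int (32 * c) else 0))"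
    for n j
  have row: "\<theta> ^ n = (\<Sum>j<7. of_rat (row n j) * \<theta> ^ j)" if "n < 13" for n
  proof -
    have delta: "(\<Sum>j<7. of_rat (if j = p then x else 0) * \<theta> ^ j) = of_rat x * \<theta> ^ p"
      if "p < 7" for p x
    proof -
      have "of_rat (if j = p then x else 0) * \<theta> ^ j = (if j = p then of_rat x * \<theta> ^ j else 0)" for j
        by simp
      thus ?thesis using that by simp
    qed
    show ?thesis
    proof (cases "n < 7")
      case True
      thus ?thesis using delta[of n 1] by (simp add: row_def)
    next
      case False
      then obtain m where m: "n = m + 7" by (metis add.commute le_Suc_ex not_less)
      have "\<theta> ^ n = \<theta> ^ m * (of_int (4 - 32 * k) * \<theta> - of_int (32 * c))"
        by (simp only: m power_add pow7)
      also have "\<dots> = of_rat (of_int (4 - 32 * k)) * \<theta> ^ (m + 1) - of_rat (of_int (32 * c)) * \<theta> ^ m"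
        unfolding of_rat_of_int_eq by (simp add: algebra_simps)
      also have "\<dots> = (\<Sum>j<7. of_rat (if j = m + 1 then of_int (4 - 32 * k) else 0) * \<theta> ^ j)
          - (\<Sum>j<7. of_rat (if j = m then of_int (32 * c) else 0) * \<theta> ^ j)"
        using delta[of "m + 1"] delta[of m] that by (simp only: m)
      also have "\<dots> = (\<Sum>j<7. of_rat (row n j) * \<theta> ^ j)"
        unfolding sum_subtractf[symmetric] left_diff_distrib[symmetric] of_rat_diff[symmetric]
        by (simp add: row_def m)
      finally show ?thesis .
    qed
  qed
  have "u * \<theta> ^ i = (\<Sum>j<7. of_rat (row (3 + i) j / 2) * \<theta> ^ j)" if "i < 7" for i
  proof -
    have "u * \<theta> ^ i = \<theta> ^ (3 + i) / 2" by (simp add: u_def power_add)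
    also have "\<dots> = (\<Sum>j<7. of_rat (row (3 + i) j) * \<theta> ^ j) / 2"
      using row[of "3 + i"] that by simp
    finally show ?thesis by (simp add: sum_divide_distrib of_rat_divide)
  qed
  hence "of_int (int_trace B u) = (\<Sum>i<7. row (3 + i) i / 2)" by (rule trace[OF uR])
  \<comment> \<open>Multiplication by \<open>\<theta> ^ 3\<close> moves exponents by 3 or, after
    reduction, by -3 and -4, so the diagonal is zero.\<close>
  also have "\<dots> = 0" by (simp add: lessThan_7 row_def)
  finally have Tu: "int_trace B u = 0" by simp
  have "w * \<theta> ^ i = (\<Sum>j<7. of_rat (row (6 + i) j / 8 - row (3 + i) j / 4) * \<theta> ^ j)"
    if "i < 7" for i
  proof -
    have "w = \<theta> ^ 6 / 8 - \<theta> ^ 3 / 4"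
      by (simp add: w_def u_def power_divide diff_divide_distrib flip: power_mult)
    hence "w * \<theta> ^ i = \<theta> ^ (6 + i) / 8 - \<theta> ^ (3 + i) / 4"
      by (simp add: power_add left_diff_distrib)
    also have "\<dots> = (\<Sum>j<7. of_rat (row (6 + i) j) * \<theta> ^ j) / 8
        - (\<Sum>j<7. of_rat (row (3 + i) j) * \<theta> ^ j) / 4"
      using row[of "3 + i"] row[of "6 + i"] that by simp
    finally show ?thesis
      by (simp add: sum_divide_distrib of_rat_divide of_rat_diff left_diff_distrib sum_subtractf)
  qed
  hence "of_int (int_trace B w) = (\<Sum>i<7. row (6 + i) i / 8 - row (3 + i) i / 4)"
    by (rule trace[OF wR])
  \<comment> \<open>\<open>\<theta> ^ 6\<close> puts \<open>4 - 32 * k\<close> at every diagonal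
    place but the first, and six times this over 8 is the odd value stated;
    \<open>\<theta> ^ 3\<close> contributes nothing.\<close>
  also have "\<dots> = of_int (3 * (1 - 8 * k))" by (simp add: lessThan_7 row_def)
  finally have Tw: "int_trace B w = 3 * (1 - 8 * k)" by (simp only: of_int_eq_iff)

  interpret three_primes R "int_trace B" \<theta> u w
  proof
    show "int_trace B (x + y) = int_trace B x + int_trace B y" if "x \<in> R" "y \<in> R" for x y
      using that by (intro int_trace_add indB RB)
    show "int_trace B (of_int j * x) = j * int_trace B x" if "x \<in> R" for x j
      using that by (intro int_trace_of_int_mult indB RB)
    show "even (int_trace B (x\<^sup>2) - int_trace B x)" if "x \<in> R" for x
      using that by (intro int_trace_square_parity finB indB RB)
    show "u * w - w \<in> R.radical" "w\<^sup>2 - w \<in> R.radical"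
      by (rule R.radical_relations[OF uR wR w rel])+
  qed (use T1 Tu Tw \<theta>R uR wR cube w in simp_all)
  show False by (rule not_power_basis[OF B_def indB spB card7])
qed

end
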